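(* Let $X$ be a separable Hilbert space, let $\mu_0 = \mathcal{N}_\Sigma$ be a nondegenerate centered Gaussian measure on $X$ (i.e. its covariance operator $\Sigma$ is injective), and let $\mu^y$ be a Borel probability measure on $X$ that is absolutely continuous with respect to $\mu_0$ with density $$\frac{\mathrm{d}\mu^y}{\mathrm{d}\mu_0}(u) = \frac{\exp(-\Phi(u))}{Z}$$ for some measurable function $\Phi: X \to \mathbb{R}$ and some constant $Z > 0$. Assume that (a) for every $r > 0$ there exists $L = L(r) > 0$ such that $|\Phi(x_1) - \Phi(x_2)| \le L\|x_1 - x_2\|_X$ for all $x_1, x_2 \in B_r(0)$; (b) there exists $\underline{L} \ge 0$ such that $\Phi(x) \ge \Phi(0) - \underline{L}\|x\|_X$ for all $x \in X$. Then a point $x \in X$ is a (strong) mode of $\mu^y$ if and only if it is a weak mode of $\mu^y$.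
   Context: $B_\varepsilon(x)$ denotes the open ball of radius $\varepsilon$ centred at $x$. Let $\mu$ be a Borel probability measure on $X$. Mode (strong mode): $\hat{x} \in X$ is a mode of $\mu$ if $\lim_{\varepsilon \to 0} \frac{\mu(B_\varepsilon(\hat{x}))}{\sup_{x \in X}\mu(B_\varepsilon(x))} = 1$. Weak mode: $\hat{x} \in \operatorname{supp}\mu$ is a weak mode of $\mu$ if $\limsup_{\varepsilon \to 0} \frac{\mu(B_\varepsilon(x))}{\mu(B_\varepsilon(\hat{x}))} \le 1$ for all $x \in X$, where $\operatorname{supp}\mu = \{x \in X : \mu(B_\varepsilon(x)) > 0 \text{ for all } \varepsilon > 0\}$. *)

theory Defs
  imports "HOL-Probability.Probability"
begin

text \<open>
  A separable real Hilbert space is a type of sort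
  \<open>{real_inner, banach, polish_space}\<close>: an inner product space that is complete and, since
  the topology is second countable, separable (for metric spaces the two notions agree).
\<close>

definition borel_prob :: "'a::topological_space measure \<Rightarrow> bool" where
  "borel_prob M \<longleftrightarrow> prob_space M \<and> sets M = sets borel"

text \<open>The one-dimensional normal law with mean \<open>m\<close> and standard deviation \<open>s\<close>; for \<open>s = 0\<close>
  it is the Dirac measure at \<open>m\<close>.\<close>

definition gaussian_real :: "real \<Rightarrow> real \<Rightarrow> real measure" where
  "gaussian_real m s =
     (if s = 0 then return borel m else density lborel (\<lambda>t. ennreal (normal_density m s t)))"

definition gaussian_measure :: "'a::real_normed_vector measure \<Rightarrow> bool" where
  "gaussian_measure M \<longleftrightarrow> borel_prob M \<and>
     (\<forall>f::'a \<Rightarrow> real. bounded_linear f \<longrightarrow>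
        (\<exists>m s. s \<ge> 0 \<and> distr M borel f = gaussian_real m s))"

text \<open>Mean and covariance are taken in the weak sense. The integrability clauses exclude the
  default value \<open>0\<close> of non-existing integrals; they hold for every Gaussian measure.\<close>

definition has_mean :: "'a::real_inner measure \<Rightarrow> 'a \<Rightarrow> bool" where
  "has_mean M m \<longleftrightarrow>
     (\<forall>h. integrable M (\<lambda>x. h \<bullet> x) \<and> (\<integral>x. h \<bullet> x \<partial>M) = h \<bullet> m)"

definition covariance_operator :: "'a::real_inner measure \<Rightarrow> ('a \<Rightarrow> 'a) \<Rightarrow> bool" where
  "covariance_operator M S \<longleftrightarrow> bounded_linear S \<and>
     (\<exists>m. has_mean M m \<and>
       (\<forall>h k. integrable M (\<lambda>x. (h \<bullet> (x - m)) * (k \<bullet> (x - m))) \<and>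
              S h \<bullet> k = (\<integral>x. (h \<bullet> (x - m)) * (k \<bullet> (x - m)) \<partial>M)))"

definition measure_support :: "'a::metric_space measure \<Rightarrow> 'a set" where
  "measure_support M = {x. \<forall>\<epsilon>>0. measure M (ball x \<epsilon>) > 0}"

definition strong_mode :: "'a::metric_space measure \<Rightarrow> 'a \<Rightarrow> bool" where
  "strong_mode M x \<longleftrightarrow>
     ((\<lambda>\<epsilon>. measure M (ball x \<epsilon>) / (SUP z. measure M (ball z \<epsilon>))) \<longlongrightarrow> 1) (at_right 0)"

text \<open>The limes superior is taken in the extended reals, since the ratio may be unbounded.\<close>

definition weak_mode :: "'a::metric_space measure \<Rightarrow> 'a \<Rightarrow> bool" where
  "weak_mode M x \<longleftrightarrow> x \<in> measure_support M \<and>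
     (\<forall>z. Limsup (at_right 0)
            (\<lambda>\<epsilon>. ereal (measure M (ball z \<epsilon>) / measure M (ball x \<epsilon>))) \<le> 1)"

end

theory Submission
  imports Defs "HOL-Complex_Analysis.Great_Picard"
begin

text \<open>For the converse direction, suppose a weak mode \<open>x\<close> is not strong. Then there are radii \<open>\<epsilon> n \<longlonglongrightarrow> 0\<close>
  and centres \<open>y n\<close> such that, for some \<open>c < 1\<close> and every fixed \<open>w\<close>, eventually
  \<open>\<mu>y(B(w, \<epsilon> n)) \<le> c * \<mu>y(B(y n, \<epsilon> n))\<close>.

  Diagonalise the covariance. Disintegrating \<open>\<mu>0\<close> along eigenvectors and applying the one-dimensional
  Anderson inequality to \<open>exp (q / 2)\<close> times \<open>\<mu>0\<close>, for a bounded quadratic form \<open>q\<close> below the squared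
  Cameron--Martin norm, bounds \<open>\<mu>0(B(y, \<epsilon>)) / \<mu>0(B(0, \<epsilon>))\<close> by about \<open>exp (- q y / 2)\<close>. Taking \<open>q\<close> to be a
  multiple of the squared norm shows that the \<open>y n\<close> are bounded; making \<open>q\<close> large off finitely many
  eigenvectors shows that they lie close to finite-dimensional subspaces, so a subsequence converges
  to some \<open>z\<close>.

  Comparing with \<open>w\<close> the projection of \<open>z\<close> to finitely many eigenvectors, whose Cameron--Martin norm is
  given by such a \<open>q\<close>, both estimates match in the limit. Since \<open>w\<close> can be chosen near \<open>z\<close>, where \<open>\<Phi>\<close> is
  continuous, this gives \<open>1 \<le> c\<close>. It is not necessary to know that \<open>z\<close> itself has finite Cameron--Martin
  norm.\<close>

subsection \<open>Measures are determined by their trigonometric integrals\<close>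

text \<open>A weak mode is tested against one fixed centre at a time, whereas the supremum in a
  strong mode allows centres that move with the radius; hence the need for a limit point
  \<open>z\<close>. The squared Cameron--Martin norm is neither continuous nor finite everywhere, so
  only bounded forms \<open>q\<close> are evaluated near \<open>z\<close>. The weight
  \<open>exp (q / 2)\<close> suits this: as long as \<open>q\<close> stays below the squared
  Cameron--Martin norm, weight times Gaussian density is still nonincreasing away from the origin on
  every line along an eigenvector, so centring a ball does not decrease its weighted mass. The
  weight is about \<open>1\<close> near the origin and at least \<open>exp (inf q / 2)\<close> on
  the ball at \<open>y\<close>. Gaussianity is given only through one-dimensional marginals.
  Splitting off an independent coordinate therefore rests on uniqueness of characteristic functions
  on the whole space, and compactness of the covariance on their continuity along weakly null
  sequences.\<close>

definition halfspace :: "'a::real_inner \<times> real \<Rightarrow> 'a set" where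
  "halfspace p = {x. fst p \<bullet> x \<le> snd p}"

lemma closed_halfspace: "closed (halfspace p)"
  unfolding halfspace_def by (rule closed_halfspace_le)

text \<open>Finite intersections of half-spaces are an intersection-stable family, as needed for
  extending equality of measures. They generate the closed balls, and separability makes every open
  set a countable union of closed balls.\<close>

lemma sets_borel_eq_halfspaces:
  "sets (borel :: 'a::{real_inner, second_countable_topology} measure)
     = sigma_sets UNIV {\<Inter>p\<in>H. halfspace p | H. finite H}" (is "_ = sigma_sets UNIV ?G")
proof
  show "sigma_sets UNIV ?G \<subseteq> sets (borel :: 'a measure)"
  proof (rule sigma_algebra.sigma_sets_subset)
    show "sigma_algebra UNIV (sets (borel :: 'a measure))"
      using sets.sigma_algebra_axioms[of "borel :: 'a measure"] by simp
    show "?G \<subseteq> sets borel"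
      by (auto intro!: borel_closed closed_halfspace)
  qed
next
  interpret sigma_algebra UNIV "sigma_sets UNIV ?G"
    by (rule sigma_algebra_sigma_sets) auto
  have half: "halfspace p \<in> sigma_sets UNIV ?G" for p :: "'a \<times> real"
    by (rule sigma_sets.Basic) (auto intro!: exI[of _ "{p}"])
  obtain D :: "'a set" where D: "countable D" "\<And>U. open U \<Longrightarrow> U \<noteq> {} \<Longrightarrow> \<exists>d\<in>D. d \<in> U"
    using countable_dense_setE by blast
  have Dne: "D \<noteq> {}"
    using D(2)[of UNIV] by auto
  have cball: "cball c r \<in> sigma_sets UNIV ?G" if r: "r > 0" for c :: 'a and r
  proof -
    \<comment> \<open>Countably many normals \<open>d\<close> suffice because the defining
      inequality is closed in \<open>d\<close> and so extends from \<open>D\<close> to all vectors;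
      testing it with \<open>d = x - c\<close> recovers the norm.\<close>
    have "cball c r = (\<Inter>d\<in>D. halfspace (d, r * norm d + d \<bullet> c))"
    proof (intro set_eqI iffI)
      fix x assume x: "x \<in> cball c r"
      have "d \<bullet> x \<le> r * norm d + d \<bullet> c" for d
      proof -
        have "d \<bullet> (x - c) \<le> norm d * norm (x - c)"
          by (rule norm_cauchy_schwarz)
        also have "\<dots> \<le> norm d * r"
          using x by (intro mult_left_mono) (auto simp: dist_norm norm_minus_commute)
        finally show ?thesis
          by (simp add: inner_diff_right mult.commute)
      qed
      then show "x \<in> (\<Inter>d\<in>D. halfspace (d, r * norm d + d \<bullet> c))"
        by (auto simp: halfspace_def)
    next
      fix x assume "x \<in> (\<Inter>d\<in>D. halfspace (d, r * norm d + d \<bullet> c))"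
      then have *: "d \<bullet> (x - c) \<le> r * norm d" if "d \<in> D" for d
        using that by (force simp: halfspace_def inner_diff_right)
      have "closed {d. d \<bullet> (x - c) \<le> r * norm d}"
        by (intro closed_Collect_le continuous_intros)
      then have op: "open {d. \<not> d \<bullet> (x - c) \<le> r * norm d}"
        by (simp add: Collect_neg_eq open_Compl)
      have "{d. \<not> d \<bullet> (x - c) \<le> r * norm d} = {}"
        using D(2)[OF op] * by auto
      then have le: "d \<bullet> (x - c) \<le> r * norm d" for d
        by auto
      show "x \<in> cball c r"
      proof (cases "x = c")
        case True
        then show ?thesis using r by simp
      next
        case False
        have "norm (x - c) * norm (x - c) \<le> r * norm (x - c)"
          using le[of "x - c"] by (simp add: power2_norm_eq_inner[symmetric] power2_eq_square)
        then show ?thesis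
          using False by (simp add: dist_norm norm_minus_commute)
      qed
    qed
    also have "\<dots> \<in> sigma_sets UNIV ?G"
      using D(1) Dne half by (intro countable_INT') auto
    finally show ?thesis .
  qed
  show "sets (borel :: 'a measure) \<subseteq> sigma_sets UNIV ?G"
  proof -
    have "U \<in> sigma_sets UNIV ?G" if "open U" for U :: "'a set"
    proof -
      have "U = (\<Union>p\<in>{p \<in> D \<times> (\<rat> \<inter> {0<..}). cball (fst p) (snd p) \<subseteq> U}. cball (fst p) (snd p))"
      proof (intro set_eqI iffI)
        fix x assume "x \<in> U"
        then obtain e where e: "e > 0" "ball x e \<subseteq> U"
          using \<open>open U\<close> openE by blast
        obtain d where d: "d \<in> D" "d \<in> ball x (e/3)"
          using D(2)[of "ball x (e/3)"] e(1) by force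
        obtain q where q: "q \<in> \<rat>" "e/3 < q" "q < e/2"
          using Rats_dense_in_real[of "e/3" "e/2"] e(1) by auto
        have "cball d q \<subseteq> ball x e"
        proof
          fix y assume "y \<in> cball d q"
          then show "y \<in> ball x e"
            using d(2) q dist_triangle[of x y d] by auto
        qed
        moreover have "x \<in> cball d q"
          using d(2) q by (auto simp: dist_commute)
        ultimately show "x \<in> (\<Union>p\<in>{p \<in> D \<times> (\<rat> \<inter> {0<..}). cball (fst p) (snd p) \<subseteq> U}. cball (fst p) (snd p))"
          using e d(1) q by (intro UN_I[of "(d, q)"]) auto
      qed auto
      also have "\<dots> \<in> sigma_sets UNIV ?G"
      proof (rule countable_UN'')
        show "countable {p \<in> D \<times> (\<rat> \<inter> {0<..}). cball (fst p) (snd p) \<subseteq> U}"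
          by (rule countable_subset[of _ "D \<times> \<rat>"]) (auto intro!: D(1) countable_rat)
      qed (auto intro!: cball)
      finally show ?thesis .
    qed
    then show ?thesis
      unfolding borel_def by (auto intro!: sigma_sets_subset)
  qed
qed

text \<open>After normalising \<open>g\<close> to a probability density, projection along
  \<open>h\<close> makes the claim one-dimensional: the characteristic function of the projected law
  at \<open>t\<close> consists of the trigonometric integrals at \<open>t *\<^sub>R h\<close>, so
  Levy uniqueness gives equal distribution functions at \<open>a\<close>.\<close>

lemma weighted_halfspace_eq:
  fixes M N :: "'a::{real_inner, second_countable_topology} measure" and h :: 'a
  assumes "finite_measure M" "finite_measure N"
    and sets: "sets M = sets borel" "sets N = sets borel"
    and g: "g \<in> borel_measurable borel" "\<And>x. 0 \<le> g x" "\<And>x. g x \<le> B"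
    and cos: "\<And>k. (\<integral>x. g x * cos (k \<bullet> x) \<partial>M) = (\<integral>x. g x * cos (k \<bullet> x) \<partial>N)"
    and sin: "\<And>k. (\<integral>x. g x * sin (k \<bullet> x) \<partial>M) = (\<integral>x. g x * sin (k \<bullet> x) \<partial>N)"
  shows "(\<integral>x. g x * indicator (halfspace (h, a)) x \<partial>M) = (\<integral>x. g x * indicator (halfspace (h, a)) x \<partial>N)"
proof -
  define c where "c = (\<integral>x. g x \<partial>M)"
  have cN: "c = (\<integral>x. g x \<partial>N)"
    using cos[of 0] by (simp add: c_def)
  have intg: "integrable L (\<lambda>x. g x * f x)" 
    if "finite_measure L" "sets L = sets borel" "f \<in> borel_measurable borel" "\<And>x. \<bar>f x\<bar> \<le> 1" for f :: "'a \<Rightarrow> real" and L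
  proof -
    interpret finite_measure L by fact
    show ?thesis
    proof (rule integrable_const_bound[of _ B])
      have "norm (g x * f x) \<le> B" for x
        using mult_mono[of "g x" B "\<bar>f x\<bar>" 1] g(2,3)[of x] that(4)[of x] by (auto simp: abs_mult)
      then show "AE x in L. norm (g x * f x) \<le> B" by simp
      show "(\<lambda>x. g x * f x) \<in> borel_measurable L"
        unfolding measurable_cong_sets[OF that(2) refl] using g(1) that(3) by simp
    qed
  qed
  have intg1: "integrable L g" if "finite_measure L" "sets L = sets borel" for L
    using intg[OF that, of "\<lambda>_. 1"] by simp
  have ind: "indicator (halfspace (h, a)) \<in> borel_measurable (borel :: 'a measure)"
    by (intro borel_measurable_indicator borel_closed closed_halfspace)
  show ?thesis
  proof (cases "c = 0")
    \<comment> \<open>Normalisation is impossible here, but both sides are squeezed between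
      \<open>0\<close> and the vanishing total mass.\<close>
    case True
    have "(\<integral>x. g x * indicator (halfspace (h, a)) x \<partial>L) = 0"
      if "finite_measure L" "sets L = sets borel" "(\<integral>x. g x \<partial>L) = 0" for L
    proof -
      have "(\<integral>x. g x * indicator (halfspace (h, a)) x \<partial>L) \<le> (\<integral>x. g x \<partial>L)"
        using g by (intro integral_mono intg intg1 that ind) (auto simp: indicator_def)
      moreover have "0 \<le> (\<integral>x. g x * indicator (halfspace (h, a)) x \<partial>L)"
        using g by (intro integral_nonneg_AE) auto
      ultimately show ?thesis using that(3) by simp
    qed
    then show ?thesis
      using True c_def cN assms(1-4) by metis
  next
    case False
    have "0 \<le> c" unfolding c_def using g by (intro integral_nonneg_AE) auto
    with False have c: "c > 0" by simp
    define Q where "Q L = distr (density L (\<lambda>x. ennreal (g x / c))) borel (\<lambda>x. h \<bullet> x)" for L :: "'a measure"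
    have Q: "real_distribution (Q L)" "char (Q L) t = Complex ((\<integral>x. g x * cos ((t *\<^sub>R h) \<bullet> x) \<partial>L) / c) ((\<integral>x. g x * sin ((t *\<^sub>R h) \<bullet> x) \<partial>L) / c)"
      "measure (Q L) {..a} = (\<integral>x. g x * indicator (halfspace (h, a)) x \<partial>L) / c"
      if L: "finite_measure L" "sets L = sets borel" "(\<integral>x. g x \<partial>L) = c" for L t
    proof -
      note meas[measurable_cong] = L(2)
      note [measurable] = g(1)
      have pr: "prob_space (density L (\<lambda>x. ennreal (g x / c)))"
      proof (rule prob_spaceI)
        have "emeasure (density L (\<lambda>x. ennreal (g x / c))) (space (density L (\<lambda>x. ennreal (g x / c)))) = (\<integral>\<^sup>+x. ennreal (g x / c) \<partial>L)"
          by (auto simp: emeasure_density cong: nn_integral_cong)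
        also have "\<dots> = ennreal (\<integral>x. g x / c \<partial>L)"
          using g c by (intro nn_integral_eq_integral) (auto intro!: intg1 L)
        also have "\<dots> = 1"
          using L(3) c by simp
        finally show "emeasure (density L (\<lambda>x. ennreal (g x / c))) (space (density L (\<lambda>x. ennreal (g x / c)))) = 1" .
      qed
      show "real_distribution (Q L)"
        unfolding Q_def real_distribution_def real_distribution_axioms_def
        by (auto intro!: prob_space.prob_space_distr pr)
      have ch: "char (Q L) t = (\<integral>x. (g x / c) *\<^sub>R iexp (t * (h \<bullet> x)) \<partial>L)"
        unfolding Q_def char_def using g c
        by (subst integral_distr) (auto simp: integral_density)
      have ie: "integrable L (\<lambda>x. (g x / c) *\<^sub>R iexp (t * (h \<bullet> x)))"
      proof -
        interpret finite_measure L by fact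
        show ?thesis
          by (rule integrable_const_bound[of _ "B / c"])
             (use g c in \<open>auto simp: field_simps\<close>)
      qed
      show "char (Q L) t = Complex ((\<integral>x. g x * cos ((t *\<^sub>R h) \<bullet> x) \<partial>L) / c) ((\<integral>x. g x * sin ((t *\<^sub>R h) \<bullet> x) \<partial>L) / c)"
        unfolding ch using ie
        by (intro complex_eqI) (simp_all flip: integral_Re integral_Im add: Re_exp Im_exp mult.commute)
      have "emeasure (Q L) {..a} = (\<integral>\<^sup>+x. ennreal (g x / c * indicator (halfspace (h, a)) x) \<partial>L)"
        unfolding Q_def
        by (subst emeasure_distr) (auto simp: emeasure_density halfspace_def indicator_def intro!: nn_integral_cong)
      also have "\<dots> = ennreal (\<integral>x. g x / c * indicator (halfspace (h, a)) x \<partial>L)"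
        using g c intg[OF L(1,2) ind] by (intro nn_integral_eq_integral) (auto simp: field_simps indicator_def)
      finally show "measure (Q L) {..a} = (\<integral>x. g x * indicator (halfspace (h, a)) x \<partial>L) / c"
        using g c by (auto simp: measure_def field_simps)
    qed
    have "Q M = Q N"
    proof (rule Levy_uniqueness)
      show "char (Q M) = char (Q N)"
        by (intro ext) (simp only: Q(2)[OF assms(1) sets(1) c_def[symmetric]] Q(2)[OF assms(2) sets(2) cN[symmetric]] cos sin)
    qed (use assms c_def cN in \<open>auto intro!: Q(1)\<close>)
    then show ?thesis
      using Q(3)[OF assms(1) sets(1) c_def[symmetric]] Q(3)[OF assms(2) sets(2) cN[symmetric]] c by simp
  qed
qed

text \<open>The property of having equal trigonometric integrals passes from a weight \<open>g\<close> to \<open>g\<close> restricted to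
  a half-space: the one-dimensional Levy uniqueness theorem applies to the nonnegative weights
  \<open>g * (1 + cos (k \<bullet> x))\<close> and \<open>g * (1 + sin (k \<bullet> x))\<close>.\<close>

lemma measure_eq_if_trig_integrals_eq:
  fixes M N :: "'a::{real_inner, second_countable_topology} measure"
  assumes "prob_space M" "prob_space N"
    and sets: "sets M = sets borel" "sets N = sets borel"
    and cos: "\<And>k. (\<integral>x. cos (k \<bullet> x) \<partial>M) = (\<integral>x. cos (k \<bullet> x) \<partial>N)"
    and sin: "\<And>k. (\<integral>x. sin (k \<bullet> x) \<partial>M) = (\<integral>x. sin (k \<bullet> x) \<partial>N)"
  shows "M = N"
proof -
  interpret M: prob_space M by fact
  interpret N: prob_space N by fact
  have intL: "integrable L (f :: 'a \<Rightarrow> real)" 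
    if "finite_measure L" "sets L = sets borel" "f \<in> borel_measurable borel" "\<And>x. \<bar>f x\<bar> \<le> B" for f L B
  proof -
    interpret finite_measure L by fact
    show ?thesis
      using that(3,4) by (intro integrable_const_bound[of _ B]) (auto simp: measurable_cong_sets[OF that(2) refl])
  qed
  let ?P = "\<lambda>g. g \<in> borel_measurable borel \<and> (\<forall>x. 0 \<le> g x \<and> g x \<le> 1) \<and>
     (\<forall>k. (\<integral>x. g x * cos (k \<bullet> x) \<partial>M) = (\<integral>x. g x * cos (k \<bullet> x) \<partial>N)) \<and>
     (\<forall>k. (\<integral>x. g x * sin (k \<bullet> x) \<partial>M) = (\<integral>x. g x * sin (k \<bullet> x) \<partial>N))"
  have step: "?P (\<lambda>x. g x * indicator (halfspace (h, a)) x)" if g: "?P g" for g h a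
  proof -
    note [measurable] = conjunct1[OF g]
    have g01: "0 \<le> g x" "g x \<le> 1" for x using g by auto
    have meas[measurable]: "halfspace (h, a) \<in> sets borel"
      by (intro borel_closed closed_halfspace)
    have trc: "(\<integral>x. g x * cos (k \<bullet> x) \<partial>M) = (\<integral>x. g x * cos (k \<bullet> x) \<partial>N)" for k
      using g by blast
    have trs: "(\<integral>x. g x * sin (k \<bullet> x) \<partial>M) = (\<integral>x. g x * sin (k \<bullet> x) \<partial>N)" for k
      using g by blast
    have gf: "integrable M (\<lambda>x. g x * f x)" "integrable N (\<lambda>x. g x * f x)"
      if [measurable]: "f \<in> borel_measurable borel" and "\<And>x. \<bar>f x\<bar> \<le> 1" for f
    proof -
      have "\<bar>g x * f x\<bar> \<le> 1" for x
        using mult_mono[of "g x" 1 "\<bar>f x\<bar>" 1] g01[of x] that(2)[of x] by (auto simp: abs_mult)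
      then show "integrable M (\<lambda>x. g x * f x)" "integrable N (\<lambda>x. g x * f x)"
        by (auto intro!: intL[OF M.finite_measure_axioms sets(1)] intL[OF N.finite_measure_axioms sets(2)])
    qed
    have eq0: "(\<integral>x. g x * indicator (halfspace (h, a)) x \<partial>M) = (\<integral>x. g x * indicator (halfspace (h, a)) x \<partial>N)"
      by (intro weighted_halfspace_eq[where B = 1] M.finite_measure_axioms N.finite_measure_axioms sets trc trs g01) measurable
    have shift: "(\<integral>x. g x * indicator (halfspace (h, a)) x * f x \<partial>M) = (\<integral>x. g x * indicator (halfspace (h, a)) x * f x \<partial>N)"
      if [measurable]: "f \<in> borel_measurable borel" and f1: "\<And>x. \<bar>f x\<bar> \<le> 1"
        and prodc: "\<And>l. (\<integral>x. g x * (f x * cos (l \<bullet> x)) \<partial>M) = (\<integral>x. g x * (f x * cos (l \<bullet> x)) \<partial>N)"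
        and prods: "\<And>l. (\<integral>x. g x * (f x * sin (l \<bullet> x)) \<partial>M) = (\<integral>x. g x * (f x * sin (l \<bullet> x)) \<partial>N)"
      for f
    proof -
      have b: "\<bar>f x * t\<bar> \<le> 1" if "\<bar>t\<bar> \<le> 1" for x t
        using mult_mono[of "\<bar>f x\<bar>" 1 "\<bar>t\<bar>" 1] f1[of x] that by (auto simp: abs_mult)
      have fge: "0 \<le> 1 + f x" "1 + f x \<le> 2" for x
        using f1[of x] by auto
      have "(\<integral>x. (g x * (1 + f x)) * indicator (halfspace (h, a)) x \<partial>M) = (\<integral>x. (g x * (1 + f x)) * indicator (halfspace (h, a)) x \<partial>N)"
      proof (rule weighted_halfspace_eq[where B = 2])
        show "g x * (1 + f x) \<le> 2" for x
          using mult_mono[of "g x" 1 "1 + f x" 2] g01[of x] fge[of x] by auto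
        show "0 \<le> g x * (1 + f x)" for x
          using g01[of x] fge[of x] by auto
        fix k
        have *: "(\<lambda>x. g x * (1 + f x) * t x) = (\<lambda>x. g x * t x + g x * (f x * t x))" for t
          by (auto simp: algebra_simps)
        show "(\<integral>x. g x * (1 + f x) * cos (k \<bullet> x) \<partial>M) = (\<integral>x. g x * (1 + f x) * cos (k \<bullet> x) \<partial>N)"
          unfolding * by (subst (1 2) Bochner_Integration.integral_add) (auto simp: trc prodc intro!: gf b)
        show "(\<integral>x. g x * (1 + f x) * sin (k \<bullet> x) \<partial>M) = (\<integral>x. g x * (1 + f x) * sin (k \<bullet> x) \<partial>N)"
          unfolding * by (subst (1 2) Bochner_Integration.integral_add) (auto simp: trs prods intro!: gf b)
      qed (simp_all add: assms(1,2) sets prob_space.finite_measure)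
      also have "(\<lambda>x. (g x * (1 + f x)) * indicator (halfspace (h, a)) x) 
         = (\<lambda>x. g x * indicator (halfspace (h, a)) x + g x * (f x * indicator (halfspace (h, a)) x))"
        by (auto simp: algebra_simps)
      finally have "(\<integral>x. g x * (f x * indicator (halfspace (h, a)) x) \<partial>M) = (\<integral>x. g x * (f x * indicator (halfspace (h, a)) x) \<partial>N)"
        using eq0 by (subst (asm) (1 2) Bochner_Integration.integral_add) (auto intro!: gf b)
      then show ?thesis
        by (simp add: ac_simps)
    qed
    \<comment> \<open>The premises of \<open>shift\<close> follow from the product formulas, which
      lead back to the frequencies \<open>k - l\<close> and \<open>k + l\<close>.\<close>
    have "(\<integral>x. g x * indicator (halfspace (h, a)) x * cos (k \<bullet> x) \<partial>M) = (\<integral>x. g x * indicator (halfspace (h, a)) x * cos (k \<bullet> x) \<partial>N)" for k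
    proof (rule shift)
      fix l
      have *: "(\<lambda>x. g x * (cos (k \<bullet> x) * cos (l \<bullet> x))) = (\<lambda>x. (g x * cos ((k - l) \<bullet> x) + g x * cos ((k + l) \<bullet> x)) / 2)"
        by (auto simp: cos_times_cos inner_add_left inner_diff_left field_simps)
      show "(\<integral>x. g x * (cos (k \<bullet> x) * cos (l \<bullet> x)) \<partial>M) = (\<integral>x. g x * (cos (k \<bullet> x) * cos (l \<bullet> x)) \<partial>N)"
        unfolding * by (simp add: gf trc trs)
      have *: "(\<lambda>x. g x * (cos (k \<bullet> x) * sin (l \<bullet> x))) = (\<lambda>x. (g x * sin ((k + l) \<bullet> x) - g x * sin ((k - l) \<bullet> x)) / 2)"
        by (auto simp: cos_times_sin inner_add_left inner_diff_left field_simps)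
      show "(\<integral>x. g x * (cos (k \<bullet> x) * sin (l \<bullet> x)) \<partial>M) = (\<integral>x. g x * (cos (k \<bullet> x) * sin (l \<bullet> x)) \<partial>N)"
        unfolding * by (simp add: gf trc trs)
    qed auto
    moreover have "(\<integral>x. g x * indicator (halfspace (h, a)) x * sin (k \<bullet> x) \<partial>M) = (\<integral>x. g x * indicator (halfspace (h, a)) x * sin (k \<bullet> x) \<partial>N)" for k
    proof (rule shift)
      fix l
      have *: "(\<lambda>x. g x * (sin (k \<bullet> x) * sin (l \<bullet> x))) = (\<lambda>x. (g x * cos ((k - l) \<bullet> x) - g x * cos ((k + l) \<bullet> x)) / 2)"
        by (auto simp: sin_times_sin inner_add_left inner_diff_left field_simps)
      show "(\<integral>x. g x * (sin (k \<bullet> x) * sin (l \<bullet> x)) \<partial>M) = (\<integral>x. g x * (sin (k \<bullet> x) * sin (l \<bullet> x)) \<partial>N)"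
        unfolding * by (simp add: gf trc trs)
      have *: "(\<lambda>x. g x * (sin (k \<bullet> x) * cos (l \<bullet> x))) = (\<lambda>x. (g x * sin ((k + l) \<bullet> x) + g x * sin ((k - l) \<bullet> x)) / 2)"
        by (simp add: sin_times_cos inner_add_left inner_diff_left distrib_left)
      show "(\<integral>x. g x * (sin (k \<bullet> x) * cos (l \<bullet> x)) \<partial>M) = (\<integral>x. g x * (sin (k \<bullet> x) * cos (l \<bullet> x)) \<partial>N)"
        unfolding * by (simp add: gf trc trs)
    qed auto
    ultimately show ?thesis
      using g01 by (auto simp: indicator_def)
  qed
  have P: "?P (indicator (\<Inter>p\<in>H. halfspace p))" if "finite H" for H
    using that
  proof (induction H rule: finite_induct)
    case empty
    then show ?case
      using cos sin M.prob_space N.prob_space by simp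
  next
    case (insert p H)
    have "?P (\<lambda>x. indicator (\<Inter>p\<in>H. halfspace p) x * indicator (halfspace (fst p, snd p)) x)"
      by (rule step) (rule insert.IH)
    also have "(\<lambda>x. indicator (\<Inter>p\<in>H. halfspace p) x * indicator (halfspace (fst p, snd p)) x)
       = (indicator (\<Inter>p\<in>insert p H. halfspace p) :: 'a \<Rightarrow> real)"
      by (auto simp: indicator_def fun_eq_iff)
    finally show ?case .
  qed
  show ?thesis
  proof (rule measure_eqI_generator_eq)
    let ?G = "{\<Inter>p\<in>H. halfspace p | H :: ('a \<times> real) set. finite H}"
    show "Int_stable ?G"
    proof (rule Int_stableI)
      fix a b assume "a \<in> ?G" "b \<in> ?G"
      then obtain H K where "finite H" "finite K" "a = (\<Inter>p\<in>H. halfspace p)" "b = (\<Inter>p\<in>K. halfspace p)" by auto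
      then show "a \<inter> b \<in> ?G"
        by (auto intro!: exI[of _ "H \<union> K"])
    qed
    show "?G \<subseteq> Pow UNIV" by simp
    show "sets M = sigma_sets UNIV ?G" "sets N = sigma_sets UNIV ?G"
      by (simp_all add: sets sets_borel_eq_halfspaces)
    show "range (\<lambda>_::nat. UNIV) \<subseteq> ?G"
      by (auto intro!: exI[of _ "{}"])
    show "emeasure M A = emeasure N A" if "A \<in> ?G" for A
    proof -
      obtain H where "finite H" and A: "A = (\<Inter>p\<in>H. halfspace p)" using \<open>A \<in> ?G\<close> by auto
      then have "(\<integral>x. indicator A x * cos (0 \<bullet> x) \<partial>M) = (\<integral>x. indicator A x * cos (0 \<bullet> x) \<partial>N)"
        using P[OF \<open>finite H\<close>] by blast
      moreover have "A \<in> sets borel"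
        unfolding A using \<open>finite H\<close> by (intro borel_closed closed_INT) (auto simp: closed_halfspace)
      ultimately show ?thesis
        using sets by (simp add: M.emeasure_eq_measure N.emeasure_eq_measure)
    qed
  qed auto
qed

subsection \<open>Compactness of the covariance operator\<close>

lemma normal_trig_integrals:
  assumes s: "0 < s"
  shows "(\<integral>t. cos (c * t) \<partial>density lborel (\<lambda>t. ennreal (normal_density 0 s t))) = exp (- (s * c)\<^sup>2 / 2)"
    and "(\<integral>t. sin (c * t) \<partial>density lborel (\<lambda>t. ennreal (normal_density 0 s t))) = 0"
proof -
  let ?N = "density lborel (\<lambda>t. ennreal (normal_density 0 s t))"
  interpret N: prob_space ?N
    using s by (rule prob_space_normal_density)
  have "distributed ?N lborel (\<lambda>t. t) (normal_density 0 s)"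
    unfolding distributed_def by (auto intro!: distr_id2)
  then have "distributed ?N lborel (\<lambda>t. (t - 0) / s) std_normal_density"
    by (rule iffD1[OF N.normal_standard_normal_convert[OF s, of "\<lambda>t. t" 0]])
  then have "distr ?N lborel (\<lambda>t. t / s) = std_normal_distribution"
    by (auto simp: distributed_def)
  then have "char (distr ?N lborel (\<lambda>t. t / s)) (s * c) = complex_of_real (exp (- (s * c)\<^sup>2 / 2))"
    by (simp add: char_std_normal_distribution)
  also have "char (distr ?N lborel (\<lambda>t. t / s)) (s * c) = (\<integral>t. iexp (c * t) \<partial>?N)"
    unfolding char_def using s by (subst integral_distr) (auto simp: field_simps)
  finally have *: "(\<integral>t. iexp (c * t) \<partial>?N) = complex_of_real (exp (- (s * c)\<^sup>2 / 2))" .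
  have i: "integrable ?N (\<lambda>t. iexp (c * t))"
    by (rule N.integrable_const_bound[of _ 1]) auto
  have "(\<integral>t. cos (c * t) \<partial>?N) = Re (\<integral>t. iexp (c * t) \<partial>?N)"
    using i by (subst integral_Re[symmetric]) (auto simp: Re_exp)
  then show "(\<integral>t. cos (c * t) \<partial>?N) = exp (- (s * c)\<^sup>2 / 2)"
    unfolding * by simp
  have "(\<integral>t. sin (c * t) \<partial>?N) = Im (\<integral>t. iexp (c * t) \<partial>?N)"
    using i by (subst integral_Im[symmetric]) (auto simp: Im_exp)
  then show "(\<integral>t. sin (c * t) \<partial>?N) = 0"
    unfolding * by simp
qed

text \<open>The exponent is the second moment rather than \<open>s\<close>, so that the covariance
  form can be inserted. For \<open>s = 0\<close> the law is a Dirac measure, which the vanishing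
  mean places at \<open>0\<close>.\<close>

lemma (in prob_space) gaussian_trig_integrals:
  assumes f[measurable]: "f \<in> borel_measurable M" and s: "s \<ge> 0"
    and distr: "distr M borel f = gaussian_real m s" and mean: "expectation f = 0"
  shows "expectation (\<lambda>x. cos (f x)) = exp (- expectation (\<lambda>x. (f x)\<^sup>2) / 2)"
    and "expectation (\<lambda>x. sin (f x)) = 0"
proof -
  have *: "expectation (\<lambda>x. g (f x)) = (\<integral>t. g t \<partial>gaussian_real m s)" 
    if [measurable]: "g \<in> borel_measurable borel" for g :: "real \<Rightarrow> real"
    unfolding distr[symmetric] by (subst integral_distr) auto
  have "expectation (\<lambda>x. cos (f x)) = exp (- expectation (\<lambda>x. (f x)\<^sup>2) / 2) \<and> expectation (\<lambda>x. sin (f x)) = 0"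
  proof (cases "s = 0")
    case True
    have g: "expectation (\<lambda>x. g (f x)) = g m" if "g \<in> borel_measurable borel" for g :: "real \<Rightarrow> real"
      using *[OF that] True that by (simp add: gaussian_real_def integral_return)
    have "m = 0"
      using g[of "\<lambda>t. t"] mean by simp
    then show ?thesis
      using g[of cos] g[of sin] g[of "\<lambda>t. t\<^sup>2"] by simp
  next
    case False
    with s have s: "s > 0" by simp
    have "distr M lborel f = distr M borel f"
      by (rule distr_cong) auto
    then have d: "distributed M lborel f (normal_density m s)"
      using False distr by (auto simp: distributed_def gaussian_real_def)
    have m: "m = 0"
      using normal_distributed_expectation[OF s d] mean by simp
    have "expectation (\<lambda>x. (f x)\<^sup>2) = s\<^sup>2"
      using normal_distributed_variance[OF s d] mean by simp
    then show ?thesis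
      using *[of cos] *[of sin] normal_trig_integrals[OF s, of 1] s m
      by (simp add: gaussian_real_def)
  qed
  then show "expectation (\<lambda>x. cos (f x)) = exp (- expectation (\<lambda>x. (f x)\<^sup>2) / 2)"
    and "expectation (\<lambda>x. sin (f x)) = 0" by auto
qed

text \<open>Weak sequential compactness, stated without the weak limit so that no Riesz representation
  is needed.\<close>

lemma bounded_seq_weakly_Cauchy_subseq:
  fixes x :: "nat \<Rightarrow> 'a::{real_inner, second_countable_topology}"
  assumes bd: "\<And>n. norm (x n) \<le> B"
  obtains r where "strict_mono r" "\<And>y. Cauchy (\<lambda>n. x (r n) \<bullet> y)"
proof -
  obtain D :: "'a set" where D: "countable D" "\<And>U. open U \<Longrightarrow> U \<noteq> {} \<Longrightarrow> \<exists>d\<in>D. d \<in> U"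
    using countable_dense_setE by blast
  have B: "B \<ge> 0" using bd[of 0] norm_ge_zero order_trans by blast
  \<comment> \<open>Passing from \<open>d\<close> to \<open>sgn d\<close> makes the bound uniform
    over \<open>D\<close>, as the diagonal selection requires; the factor \<open>norm d\<close> is
    restored afterwards.\<close>
  have bd': "norm (x n \<bullet> sgn d) \<le> B" for n d
  proof -
    have "norm (x n \<bullet> sgn d) \<le> norm (x n) * norm (sgn d)"
      using Cauchy_Schwarz_ineq2[of "x n" "sgn d"] by simp
    also have "\<dots> \<le> B * 1"
      using bd[of n] B by (intro mult_mono) (auto simp: norm_sgn)
    finally show ?thesis by simp
  qed
  obtain r where r: "strict_mono r" "\<And>d. d \<in> D \<Longrightarrow> \<exists>l. (\<lambda>n. x (r n) \<bullet> sgn d) \<longlonglongrightarrow> l"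
    using function_convergent_subsequence[OF D(1), of "\<lambda>n d. x n \<bullet> sgn d" B] bd' by metis
  have "Cauchy (\<lambda>n. x (r n) \<bullet> y)" for y
  proof (rule CauchyI)
    fix e :: real assume e: "e > 0"
    define e' where "e' = e / (3 * (B + 1))"
    have e': "e' > 0" using e B by (simp add: e'_def)
    obtain d where d: "d \<in> D" "norm (y - d) < e'"
      using D(2)[of "ball y e'"] e' by (auto simp: dist_norm)
    obtain l where "(\<lambda>n. x (r n) \<bullet> sgn d) \<longlonglongrightarrow> l"
      using r(2) d(1) by blast
    then have "(\<lambda>n. norm d * (x (r n) \<bullet> sgn d)) \<longlonglongrightarrow> norm d * l"
      by (intro tendsto_intros)
    moreover have "norm d * (z \<bullet> sgn d) = z \<bullet> d" for z
      by (cases "d = 0") (auto simp: sgn_div_norm)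
    ultimately have "(\<lambda>n. x (r n) \<bullet> d) \<longlonglongrightarrow> norm d * l" by simp
    then have "Cauchy (\<lambda>n. x (r n) \<bullet> d)"
      by (rule LIMSEQ_imp_Cauchy)
    then obtain K where K: "\<And>m n. m \<ge> K \<Longrightarrow> n \<ge> K \<Longrightarrow> norm (x (r m) \<bullet> d - x (r n) \<bullet> d) < e / 3"
      using e CauchyD[of "\<lambda>n. x (r n) \<bullet> d" "e/3"] by auto
    have near: "\<bar>z \<bullet> y - z \<bullet> d\<bar> \<le> e / 3" if "norm z \<le> B" for z
    proof -
      have "\<bar>z \<bullet> y - z \<bullet> d\<bar> \<le> norm z * norm (y - d)"
        using Cauchy_Schwarz_ineq2[of z "y - d"] by (simp add: inner_diff_right)
      also have "\<dots> \<le> (B + 1) * e'"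
        using that d(2) B by (intro mult_mono) auto
      also have "\<dots> = e / 3" using B e by (simp add: e'_def field_simps)
      finally show ?thesis .
    qed
    show "\<exists>K. \<forall>m\<ge>K. \<forall>n\<ge>K. norm (x (r m) \<bullet> y - x (r n) \<bullet> y) < e"
    proof (intro exI allI impI)
      fix m n assume "m \<ge> K" "n \<ge> K"
      then show "norm (x (r m) \<bullet> y - x (r n) \<bullet> y) < e"
        using K[of m n] near[OF bd, of "r m"] near[OF bd, of "r n"] by (simp add: abs_if split: if_splits)
    qed
  qed
  with r(1) that show ?thesis by blast
qed

text \<open>Evaluate the nonnegative form at \<open>x - t *\<^sub>R T x\<close> with the optimal
  \<open>t = 1 / B\<close>. The restriction to an invariant subspace \<open>W\<close> serves the
  search for eigenvectors, where the operator is positive only on \<open>W\<close>.\<close>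

lemma psd_norm_le:
  fixes T :: "'a::real_inner \<Rightarrow> 'a"
  assumes T: "linear T" and sym: "\<And>x y. T x \<bullet> y = x \<bullet> T y"
    and W: "subspace W" "\<And>x. x \<in> W \<Longrightarrow> T x \<in> W"
    and psd: "\<And>x. x \<in> W \<Longrightarrow> 0 \<le> T x \<bullet> x"
    and B: "B > 0" "\<And>x. x \<in> W \<Longrightarrow> T x \<bullet> x \<le> B * (norm x)\<^sup>2" and x: "x \<in> W"
  shows "(norm (T x))\<^sup>2 \<le> B * (T x \<bullet> x)"
proof -
  define t where "t = 1 / B"
  have t: "t * B = 1" "t > 0" using B by (auto simp: t_def)
  define y where "y = T x"
  have y: "y \<in> W" using x W by (simp add: y_def)
  have "x - t *\<^sub>R y \<in> W" using x y W(1) by (intro subspace_diff subspace_scale)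
  then have "0 \<le> T (x - t *\<^sub>R y) \<bullet> (x - t *\<^sub>R y)" by (rule psd)
  also have "\<dots> = y \<bullet> x - 2 * t * (norm y)\<^sup>2 + t\<^sup>2 * (T y \<bullet> y)"
    using sym[of y x] T
    by (simp add: linear_diff linear_scale y_def[symmetric]
        power2_eq_square power2_norm_eq_inner[unfolded power2_eq_square] algebra_simps)
  also have "\<dots> \<le> y \<bullet> x - 2 * t * (norm y)\<^sup>2 + t\<^sup>2 * (B * (norm y)\<^sup>2)"
    using B(2)[OF y] by (intro add_left_mono mult_left_mono) auto
  also have "t\<^sup>2 * (B * (norm y)\<^sup>2) = t * (norm y)\<^sup>2"
    using t(1) by (metis (no_types, opaque_lifting) mult.assoc mult.right_neutral mult.commute power2_eq_square)
  finally have "t * (norm y)\<^sup>2 \<le> y \<bullet> x" by simp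
  then have "B * (t * (norm y)\<^sup>2) \<le> B * (y \<bullet> x)" using B by (intro mult_left_mono) auto
  then show ?thesis using t(1) by (simp add: y_def mult.assoc[symmetric] mult.commute[of B])
qed

text \<open>Gaussianity enters only through the characteristic function, split into its cosine and
  sine parts.\<close>

locale centered_gaussian = prob_space M
  for M :: "'a::{real_inner, banach, polish_space} measure" +
  fixes S :: "'a \<Rightarrow> 'a"
  assumes sets_M: "sets M = sets borel"
    and bl: "bounded_linear S"
    and sym: "S h \<bullet> k = h \<bullet> S k"
    and psd: "0 \<le> S h \<bullet> h"
    and inj: "S h = 0 \<Longrightarrow> h = 0"
    and int_cos: "(\<integral>x. cos (k \<bullet> x) \<partial>M) = exp (- (S k \<bullet> k) / 2)"
    and int_sin: "(\<integral>x. sin (k \<bullet> x) \<partial>M) = 0"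
begin

declare sets_M [measurable_cong]

text \<open>The summand \<open>1\<close> gives \<open>B \<ge> 1\<close>, so division by
  \<open>B\<close> is safe and additive constants can be absorbed into multiples of
  \<open>B\<close>.\<close>

definition B where "B = onorm S + 1"

lemma B_pos: "B > 0"
  using onorm_pos_le[OF bl] by (simp add: B_def)

lemma S_le: "S x \<bullet> x \<le> B * (norm x)\<^sup>2"
proof -
  have "S x \<bullet> x \<le> norm (S x) * norm x" by (rule norm_cauchy_schwarz)
  also have "\<dots> \<le> (onorm S * norm x) * norm x"
    by (intro mult_right_mono onorm[OF bl]) auto
  also have "\<dots> \<le> B * (norm x)\<^sup>2"
    by (simp add: B_def power2_eq_square algebra_simps)
  finally show ?thesis .
qed

lemma norm_S_le: "(norm (S x))\<^sup>2 \<le> B * (S x \<bullet> x)"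
  by (rule psd_norm_le[where W = UNIV])
     (auto intro: bounded_linear.linear bl sym psd B_pos S_le)

lemma S_pos: "x \<noteq> 0 \<Longrightarrow> S x \<bullet> x > 0"
proof -
  assume "x \<noteq> 0"
  then have "norm (S x) \<noteq> 0" using inj by auto
  then have "0 < (norm (S x))\<^sup>2" by simp
  also note norm_S_le
  finally show ?thesis using B_pos by (simp add: zero_less_mult_iff)
qed

text \<open>Dominated convergence sends the characteristic function at \<open>d n\<close> to
  \<open>1\<close>, so the exponent \<open>S (d n) \<bullet> d n\<close> vanishes in the limit, and
  \<open>norm_S_le\<close> controls \<open>S (d n)\<close> by it. This is where compactness of
  \<open>S\<close> comes from.\<close>

lemma weakly_null_imp_S_null:
  assumes "\<And>y. (\<lambda>n. d n \<bullet> y) \<longlonglongrightarrow> 0"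
  shows "(\<lambda>n. S (d n)) \<longlonglongrightarrow> 0"
proof -
  have "(\<lambda>n. \<integral>x. cos (d n \<bullet> x) \<partial>M) \<longlonglongrightarrow> (\<integral>x. 1 \<partial>M)"
  proof (rule integral_dominated_convergence[where w = "\<lambda>_. 1"])
    show "AE x in M. (\<lambda>n. cos (d n \<bullet> x)) \<longlonglongrightarrow> 1"
      using tendsto_cos[OF assms] by simp
  qed auto
  then have "(\<lambda>n. exp (- (S (d n) \<bullet> d n) / 2)) \<longlonglongrightarrow> 1"
    by (simp add: int_cos prob_space)
  then have "(\<lambda>n. - 2 * B * ln (exp (- (S (d n) \<bullet> d n) / 2))) \<longlonglongrightarrow> - 2 * B * ln 1"
    by (intro tendsto_intros) auto
  moreover have "(\<lambda>n. - 2 * B * ln (exp (- (S (d n) \<bullet> d n) / 2))) = (\<lambda>n. B * (S (d n) \<bullet> d n))"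
    by (simp only: ln_exp) simp
  ultimately have lim: "(\<lambda>n. B * (S (d n) \<bullet> d n)) \<longlonglongrightarrow> 0" by (simp only: ln_one mult_zero_right)
  have "(\<lambda>n. (norm (S (d n)))\<^sup>2) \<longlonglongrightarrow> 0"
    by (rule tendsto_sandwich[OF _ _ tendsto_const lim])
       (rule always_eventually, rule allI, rule zero_le_power2, rule always_eventually, rule allI, rule norm_S_le)
  then have "(\<lambda>n. sqrt ((norm (S (d n)))\<^sup>2)) \<longlonglongrightarrow> sqrt 0"
    by (intro tendsto_intros)
  then show ?thesis by (simp add: tendsto_norm_zero_iff)
qed

text \<open>If the images were not Cauchy, differences along a bad choice of indices would be weakly
  null while their images stay away from \<open>0\<close>.\<close>

lemma weakly_Cauchy_imp_S_convergent:
  assumes x: "\<And>y. Cauchy (\<lambda>n. x n \<bullet> y)"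
  shows "convergent (\<lambda>n. S (x n))"
proof -
  have "Cauchy (\<lambda>n. S (x n))"
  proof (rule ccontr)
    assume "\<not> Cauchy (\<lambda>n. S (x n))"
    then obtain e where e: "e > 0" "\<And>K. \<exists>m\<ge>K. \<exists>n\<ge>K. norm (S (x m) - S (x n)) \<ge> e"
      unfolding Cauchy_iff by (auto simp: not_less)
    then obtain m n where mn: "\<And>K. m K \<ge> K" "\<And>K. n K \<ge> K" "\<And>K. norm (S (x (m K)) - S (x (n K))) \<ge> e"
      by metis
    have "(\<lambda>K. (x (m K) - x (n K)) \<bullet> y) \<longlonglongrightarrow> 0" for y
    proof (rule LIMSEQ_I)
      fix r :: real assume "r > 0"
      then obtain L where L: "\<And>i j. i \<ge> L \<Longrightarrow> j \<ge> L \<Longrightarrow> norm (x i \<bullet> y - x j \<bullet> y) < r"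
        using CauchyD[OF x] by metis
      show "\<exists>no. \<forall>K\<ge>no. norm ((x (m K) - x (n K)) \<bullet> y - 0) < r"
      proof (intro exI[of _ L] allI impI)
        fix K assume "K \<ge> L"
        then show "norm ((x (m K) - x (n K)) \<bullet> y - 0) < r"
          using L[of "m K" "n K"] mn(1,2)[of K] by (simp add: inner_diff_left)
      qed
    qed
    then have "(\<lambda>K. S (x (m K) - x (n K))) \<longlonglongrightarrow> 0"
      by (rule weakly_null_imp_S_null)
    then have "(\<lambda>K. norm (S (x (m K)) - S (x (n K)))) \<longlonglongrightarrow> 0"
      by (simp add: tendsto_norm_zero_iff linear_diff[OF bounded_linear.linear[OF bl]])
    then have "e \<le> 0"
      by (rule LIMSEQ_le_const) (use mn(3) in blast)
    with e show False by simp
  qed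
  then show ?thesis by (simp add: Cauchy_convergent_iff)
qed

lemma compact_S:
  fixes x :: "nat \<Rightarrow> 'a"
  assumes "\<And>n. norm (x n) \<le> C"
  obtains r :: "nat \<Rightarrow> nat" where "strict_mono r" "convergent (\<lambda>n. S (x (r n)))"
proof -
  obtain r :: "nat \<Rightarrow> nat" where "strict_mono r" "\<And>y. Cauchy (\<lambda>n. x (r n) \<bullet> y)"
    using bounded_seq_weakly_Cauchy_subseq[of x C, OF assms] by blast
  then show ?thesis
    by (intro that[of r] weakly_Cauchy_imp_S_convergent)
qed

text \<open>Maximise the Rayleigh quotient over the unit sphere of \<open>W\<close>, with supremum
  \<open>l\<close>. The operator \<open>T = l - S\<close> is positive on \<open>W\<close>, so
  \<open>psd_norm_le\<close> forces \<open>T (x n)\<close> to \<open>0\<close> along a maximising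
  sequence. Compactness makes \<open>S (x n)\<close> converge along a subsequence, and
  \<open>l > 0\<close> carries this over to the vectors themselves.\<close>

lemma eigenvector_exists:
  assumes W: "subspace W" "closed W" "\<And>x. x \<in> W \<Longrightarrow> S x \<in> W" and w: "w \<in> W" "w \<noteq> 0"
  obtains e l where "e \<in> W" "norm e = 1" "S e = l *\<^sub>R e"
proof -
  define Q where "Q = (\<lambda>x. S x \<bullet> x) ` {x \<in> W. norm x = 1}"
  have "sgn w \<in> W" using w W(1) by (auto simp: sgn_div_norm subspace_scale)
  then have s1: "sgn w \<in> {x \<in> W. norm x = 1}" using w by (simp add: norm_sgn)
  then have ne: "Q \<noteq> {}" unfolding Q_def by blast
  have bdd: "bdd_above Q" 
  proof (rule bdd_aboveI[of _ B])
    fix v assume "v \<in> Q"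
    then obtain x where "v = S x \<bullet> x" "norm x = 1" by (auto simp: Q_def)
    then show "v \<le> B" using S_le[of x] by simp
  qed
  define l where "l = Sup Q"
  have upper: "S x \<bullet> x \<le> l * (norm x)\<^sup>2" if "x \<in> W" for x
  proof (cases "x = 0")
    case False
    have "sgn x \<in> W" using that W(1) by (auto simp: sgn_div_norm subspace_scale)
    then have "S (sgn x) \<bullet> sgn x \<in> Q"
      using False by (auto simp: Q_def norm_sgn)
    then have "S (sgn x) \<bullet> sgn x \<le> l"
      unfolding l_def by (rule cSup_upper[OF _ bdd])
    moreover have "S (sgn x) \<bullet> sgn x = (S x \<bullet> x) / (norm x)\<^sup>2"
      by (simp add: sgn_div_norm linear_scale[OF bounded_linear.linear[OF bl]] power2_eq_square field_simps)
    ultimately show ?thesis using False by (simp add: field_simps)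
  qed simp
  have "0 < S (sgn w) \<bullet> sgn w"
    using w by (intro S_pos) (simp add: sgn_zero_iff)
  also have "\<dots> \<le> l"
    unfolding l_def using s1 by (intro cSup_upper bdd) (auto simp: Q_def)
  finally have l: "l > 0" .
  have "\<exists>x\<in>W. norm x = 1 \<and> l - inverse (real (Suc n)) < S x \<bullet> x" for n
    using less_cSup_iff[OF ne bdd, of "l - inverse (real (Suc n))"]
    by (auto simp: l_def Q_def)
  then obtain x where x: "\<And>n. x n \<in> W" "\<And>n. norm (x n) = 1" "\<And>n. l - inverse (real (Suc n)) < S (x n) \<bullet> x n"
    by metis
  have x_le: "S (x n) \<bullet> x n \<le> l" for n using upper[OF x(1)[of n]] x(2)[of n] by simp
  define T where "T y = l *\<^sub>R y - S y" for y
  have blT: "bounded_linear T"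
    unfolding T_def by (intro bounded_linear_intros bl)
  have T1: "(norm (T (x n)))\<^sup>2 \<le> l * (T (x n) \<bullet> x n)" for n
  proof (rule psd_norm_le[where W = W])
    show "0 \<le> T y \<bullet> y" if "y \<in> W" for y
      using upper[OF that] by (simp add: T_def inner_diff_left power2_norm_eq_inner)
    show "T y \<bullet> y \<le> l * (norm y)\<^sup>2" for y
      using psd[of y] by (simp add: T_def inner_diff_left power2_norm_eq_inner)
    show "T y \<in> W" if "y \<in> W" for y
      using that W by (simp add: T_def subspace_diff subspace_scale)
    show "T y \<bullet> z = y \<bullet> T z" for y z
      by (simp add: T_def inner_diff_left inner_diff_right sym)
  qed (use blT W x l in \<open>auto intro: bounded_linear.linear\<close>)
  have T2: "T (x n) \<bullet> x n \<le> inverse (real (Suc n))" for n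
    using x(3)[of n] x(2)[of n] by (simp add: T_def inner_diff_left power2_norm_eq_inner[symmetric])
  have T3: "(norm (T (x n)))\<^sup>2 \<le> l * inverse (real (Suc n))" for n
    using T1[of n] mult_left_mono[OF T2[of n], of l] l by linarith
  have "(\<lambda>n. (norm (T (x n)))\<^sup>2) \<longlonglongrightarrow> 0"
    by (rule tendsto_sandwich[OF _ _ tendsto_const tendsto_mult_right_zero[OF LIMSEQ_inverse_real_of_nat, of l]])
       (rule always_eventually, rule allI, rule zero_le_power2, rule always_eventually, rule allI, rule T3)
  then have "(\<lambda>n. sqrt ((norm (T (x n)))\<^sup>2)) \<longlonglongrightarrow> sqrt 0"
    by (intro tendsto_intros)
  then have T0: "(\<lambda>n. T (x n)) \<longlonglongrightarrow> 0" by (simp add: tendsto_norm_zero_iff)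
  obtain r where r: "strict_mono r" "convergent (\<lambda>n. S (x (r n)))"
    using compact_S[of x 1] x(2) by auto
  then obtain y where y: "(\<lambda>n. S (x (r n))) \<longlonglongrightarrow> y" by (auto simp: convergent_def)
  have "(\<lambda>n. T (x (r n))) \<longlonglongrightarrow> 0"
    using LIMSEQ_subseq_LIMSEQ[OF T0 r(1)] by (simp add: o_def)
  from tendsto_add[OF this y] have "(\<lambda>n. l *\<^sub>R x (r n)) \<longlonglongrightarrow> y"
    by (simp add: T_def)
  then have "(\<lambda>n. inverse l *\<^sub>R (l *\<^sub>R x (r n))) \<longlonglongrightarrow> inverse l *\<^sub>R y"
    by (intro tendsto_intros)
  then have lim: "(\<lambda>n. x (r n)) \<longlonglongrightarrow> inverse l *\<^sub>R y" (is "_ \<longlonglongrightarrow> ?e")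
    using l by simp
  have "S ?e = y"
    by (rule LIMSEQ_unique[OF bounded_linear.tendsto[OF bl lim] y])
  then have e1: "S ?e = l *\<^sub>R ?e"
    using l by simp
  have e2: "norm ?e = 1"
    using tendsto_norm[OF lim] unfolding x(2) by (simp only: LIMSEQ_const_iff)
  have "?e \<in> W"
    by (rule closed_sequentially[OF W(2) _ lim]) (rule x(1))
  then show ?thesis using e2 e1 by (rule that)
qed

subsection \<open>Diagonalisation\<close>

definition orthonormal_eigenvectors :: "'a set \<Rightarrow> bool" where
  "orthonormal_eigenvectors A \<longleftrightarrow>
     (\<forall>e\<in>A. norm e = 1 \<and> (\<exists>l. S e = l *\<^sub>R e)) \<and> (\<forall>e\<in>A. \<forall>f\<in>A. e \<noteq> f \<longrightarrow> e \<bullet> f = 0)"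

text \<open>Take a maximal orthonormal system of eigenvectors. Its orthogonal complement is closed
  and invariant under \<open>S\<close>, so if it were nonzero it would contain a further
  eigenvector.\<close>

lemma eigenbasis_exists:
  "\<exists>A. orthonormal_eigenvectors A \<and> (\<forall>w. (\<forall>e\<in>A. w \<bullet> e = 0) \<longrightarrow> w = 0)"
proof -
  have "\<exists>A\<in>Collect orthonormal_eigenvectors. \<forall>A'\<in>Collect orthonormal_eigenvectors. A \<subseteq> A' \<longrightarrow> A' = A"
  proof (rule subset_Zorn_nonempty)
    show "Collect orthonormal_eigenvectors \<noteq> {}"
      by (auto simp: orthonormal_eigenvectors_def intro!: exI[of _ "{}"])
    fix C assume "C \<noteq> {}" and C: "subset.chain (Collect orthonormal_eigenvectors) C"
    have "e \<bullet> f = 0" if "X \<in> C" "e \<in> X" "Y \<in> C" "f \<in> Y" "e \<noteq> f" for e f X Y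
    proof -
      have "X \<subseteq> Y \<or> Y \<subseteq> X" "orthonormal_eigenvectors X" "orthonormal_eigenvectors Y"
        using C that by (auto simp: subset.chain_def subset_chain_def)
      then show ?thesis
        using that unfolding orthonormal_eigenvectors_def by blast
    qed
    then show "\<Union>C \<in> Collect orthonormal_eigenvectors"
      using C by (auto simp: orthonormal_eigenvectors_def subset_chain_def)
  qed
  then obtain A where A: "orthonormal_eigenvectors A"
    and max: "\<And>A'. orthonormal_eigenvectors A' \<Longrightarrow> A \<subseteq> A' \<Longrightarrow> A' = A" by auto
  define W where "W = {w. \<forall>e\<in>A. w \<bullet> e = 0}"
  have "w = 0" if "w \<in> W" for w
  proof (rule ccontr)
    assume "w \<noteq> 0"
    have sub: "subspace W"
      by (auto simp: W_def subspace_def inner_add_left)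
    have "closed W"
    proof -
      have "W = (\<Inter>e\<in>A. {w. w \<bullet> e = 0})" by (auto simp: W_def)
      also have "closed \<dots>"
        by (intro closed_INT ballI closed_Collect_eq continuous_intros)
      finally show ?thesis .
    qed
    have inv: "S x \<in> W" if x: "x \<in> W" for x
    proof -
      have "S x \<bullet> e = 0" if e: "e \<in> A" for e
      proof -
        obtain l where "S e = l *\<^sub>R e" using A e unfolding orthonormal_eigenvectors_def by blast
        then show ?thesis using x e by (simp add: sym W_def)
      qed
      then show ?thesis by (simp add: W_def)
    qed
    obtain e l where e: "e \<in> W" "norm e = 1" "S e = l *\<^sub>R e"
      using eigenvector_exists[OF sub \<open>closed W\<close> inv \<open>w \<in> W\<close> \<open>w \<noteq> 0\<close>] by blast
    have "orthonormal_eigenvectors (insert e A)"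
      using A e by (auto simp: orthonormal_eigenvectors_def W_def inner_commute)
    then have "e \<in> A" using max[of "insert e A"] by auto
    then have "e \<bullet> e = 0" using e(1) by (simp add: W_def)
    then show False using e(2) by simp
  qed
  then show ?thesis using A by (auto simp: W_def)
qed

definition E where
  "E = (SOME A. orthonormal_eigenvectors A \<and> (\<forall>w. (\<forall>e\<in>A. w \<bullet> e = 0) \<longrightarrow> w = 0))"

definition lam :: "'a \<Rightarrow> real" where "lam e = S e \<bullet> e"

lemma E: "orthonormal_eigenvectors E" and E_complete: "(\<And>e. e \<in> E \<Longrightarrow> w \<bullet> e = 0) \<Longrightarrow> w = 0"
  using someI_ex[OF eigenbasis_exists] unfolding E_def by blast+

lemma norm_E [simp]: "e \<in> E \<Longrightarrow> norm e = 1"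
  and inner_E: "e \<in> E \<Longrightarrow> f \<in> E \<Longrightarrow> e \<bullet> f = (if e = f then 1 else 0)"
  using E by (auto simp: orthonormal_eigenvectors_def norm_eq_1)

lemma S_E: "e \<in> E \<Longrightarrow> S e = lam e *\<^sub>R e"
proof -
  assume e: "e \<in> E"
  then obtain l where l: "S e = l *\<^sub>R e" using E unfolding orthonormal_eigenvectors_def by blast
  moreover have "lam e = l" using inner_E[OF e e] l by (simp add: lam_def)
  ultimately show ?thesis by simp
qed

lemma lam_pos: "e \<in> E \<Longrightarrow> lam e > 0"
  unfolding lam_def using norm_E[of e] by (intro S_pos) (auto simp del: norm_E)

lemma lam_le_B: "e \<in> E \<Longrightarrow> lam e \<le> B"
  using S_le[of e] by (simp add: lam_def)

text \<open>Infinitely many such eigenvectors would have images at mutual distance at least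
  \<open>l\<close>, seen by pairing a difference with one of them; compactness forbids this.\<close>

lemma finite_lam_ge:
  assumes l: "l > 0"
  shows "finite {e \<in> E. lam e \<ge> l}"
proof (rule ccontr)
  assume "infinite {e \<in> E. lam e \<ge> l}"
  then obtain h :: "nat \<Rightarrow> 'a" where h: "inj h" "range h \<subseteq> {e \<in> E. lam e \<ge> l}"
    using infinite_countable_subset by blast
  have hE: "h n \<in> E" "lam (h n) \<ge> l" for n using h(2) by auto
  obtain r :: "nat \<Rightarrow> nat" where r: "strict_mono r" "convergent (\<lambda>n. S (h (r n)))"
    using compact_S[of h 1] hE by auto
  have "Cauchy (\<lambda>n. S (h (r n)))" using r(2) by (rule convergent_Cauchy)
  then obtain K where K: "\<And>m n. m \<ge> K \<Longrightarrow> n \<ge> K \<Longrightarrow> norm (S (h (r m)) - S (h (r n))) < l"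
    using CauchyD[OF _ l] by blast
  define e f where "e = h (r K)" and "f = h (r (Suc K))"
  have "r K \<noteq> r (Suc K)" using strict_mono_less[OF r(1), of K "Suc K"] by auto
  then have "e \<noteq> f" using h(1) by (auto simp: e_def f_def inj_eq)
  then have ef: "e \<in> E" "f \<in> E" "e \<bullet> f = 0" "lam e \<ge> l"
    using hE inner_E by (auto simp: e_def f_def)
  have "l \<le> lam e" by fact
  also have "lam e = (S e - S f) \<bullet> e"
    using ef inner_E[of e e] by (simp add: S_E inner_diff_left inner_commute[of f e])
  also have "\<dots> \<le> norm (S e - S f) * norm e" by (rule norm_cauchy_schwarz)
  also have "\<dots> < l" using K[of K "Suc K"] ef by (simp add: e_def f_def)
  finally show False by simp
qed

definition proj :: "'a set \<Rightarrow> 'a \<Rightarrow> 'a" where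
  "proj F x = (\<Sum>e\<in>F. (x \<bullet> e) *\<^sub>R e)"

lemma proj_inner:
  assumes "finite F" "F \<subseteq> E" "e \<in> E"
  shows "proj F x \<bullet> e = (if e \<in> F then x \<bullet> e else 0)"
proof -
  have "proj F x \<bullet> e = (\<Sum>f\<in>F. if e = f then x \<bullet> e else 0)"
    unfolding proj_def inner_sum_left using assms by (intro sum.cong) (auto simp: inner_E)
  also have "\<dots> = (if e \<in> F then x \<bullet> e else 0)"
    using assms(1) by simp
  finally show ?thesis .
qed

lemma proj_inner_proj:
  assumes "finite F" "F \<subseteq> E" "finite G" "G \<subseteq> E" "F \<subseteq> G"
  shows "proj F x \<bullet> proj G x = (\<Sum>e\<in>F. (x \<bullet> e)\<^sup>2)"
proof -
  have "proj F x \<bullet> proj G x = (\<Sum>e\<in>F. (x \<bullet> e) * (proj G x \<bullet> e))"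
    unfolding proj_def[of F] inner_sum_left by (simp add: inner_commute)
  also have "\<dots> = (\<Sum>e\<in>F. (x \<bullet> e)\<^sup>2)"
  proof (intro sum.cong refl)
    fix e assume "e \<in> F"
    then have "e \<in> G" "e \<in> E" using assms by auto
    then show "(x \<bullet> e) * (proj G x \<bullet> e) = (x \<bullet> e)\<^sup>2"
      using proj_inner[OF assms(3,4)] by (simp add: power2_eq_square)
  qed
  finally show ?thesis .
qed

lemma norm_proj_diff:
  assumes "finite F" "F \<subseteq> E" "finite G" "G \<subseteq> E" "F \<subseteq> G"
  shows "(norm (proj G x - proj F x))\<^sup>2 = (\<Sum>e\<in>G. (x \<bullet> e)\<^sup>2) - (\<Sum>e\<in>F. (x \<bullet> e)\<^sup>2)"
  using proj_inner_proj[OF assms, of x] proj_inner_proj[OF assms(3,4) assms(3,4), of x]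
    proj_inner_proj[OF assms(1,2) assms(1,2), of x]
  by (simp add: power2_norm_eq_inner inner_diff_left inner_diff_right inner_commute)

lemma norm_diff_proj:
  assumes "finite F" "F \<subseteq> E"
  shows "(norm (x - proj F x))\<^sup>2 = (norm x)\<^sup>2 - (\<Sum>e\<in>F. (x \<bullet> e)\<^sup>2)"
proof -
  have "x \<bullet> proj F x = (\<Sum>e\<in>F. (x \<bullet> e)\<^sup>2)"
    unfolding proj_def inner_sum_right by (simp add: power2_eq_square)
  then show ?thesis
    using proj_inner_proj[OF assms assms, of x]
    by (simp add: power2_norm_eq_inner inner_diff_left inner_diff_right inner_commute)
qed

text \<open>The eigenvalue thresholds \<open>inverse (Suc n)\<close> exhaust \<open>E\<close> by
  finite sets without any enumeration, because every eigenvalue is positive. Bessel's inequality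
  makes the projections Cauchy, and completeness of \<open>E\<close> identifies their limit as
  \<open>x\<close>.\<close>

lemma proj_approx:
  assumes \<delta>: "\<delta> > 0"
  obtains F where "finite F" "F \<subseteq> E" "norm (x - proj F x) < \<delta>"
proof -
  define F where "F n = {e \<in> E. lam e \<ge> inverse (real (Suc n))}" for n
  have F: "finite (F n)" "F n \<subseteq> E" for n
    using finite_lam_ge[of "inverse (real (Suc n))"] by (auto simp: F_def)
  have mono: "F m \<subseteq> F n" if "m \<le> n" for m n
  proof -
    have "inverse (real (Suc n)) \<le> inverse (real (Suc m))" using that by simp
    then show ?thesis unfolding F_def using order_trans by blast
  qed
  define s where "s n = (\<Sum>e\<in>F n. (x \<bullet> e)\<^sup>2)" for n
  have s_le: "s n \<le> (norm x)\<^sup>2" for n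
    using norm_diff_proj[OF F, of x n] zero_le_power2[of "norm (x - proj (F n) x)"] by (simp add: s_def)
  have "incseq s"
    unfolding s_def incseq_def using F(1) mono by (intro allI impI sum_mono2) auto
  then have "convergent s"
    using s_le by (metis convergent_def incseq_convergent)
  then have "Cauchy s" by (rule convergent_Cauchy)
  have "Cauchy (\<lambda>n. proj (F n) x)"
  proof (rule CauchyI)
    fix e :: real assume "e > 0"
    then obtain K where K: "\<And>m n. m \<ge> K \<Longrightarrow> n \<ge> K \<Longrightarrow> norm (s m - s n) < e\<^sup>2"
      using CauchyD[OF \<open>Cauchy s\<close>, of "e\<^sup>2"] by auto
    have *: "norm (proj (F n) x - proj (F m) x) < e" if "m \<ge> K" "m \<le> n" for m n
    proof -
      have "(norm (proj (F n) x - proj (F m) x))\<^sup>2 < e\<^sup>2"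
        using norm_proj_diff[OF F F mono[OF that(2)], of x] K[of n m] that by (simp add: s_def)
      then show ?thesis using \<open>e > 0\<close> by (simp add: power2_less_imp_less)
    qed
    show "\<exists>K. \<forall>m\<ge>K. \<forall>n\<ge>K. norm (proj (F m) x - proj (F n) x) < e"
    proof (intro exI allI impI)
      fix m n assume "m \<ge> K" "n \<ge> K"
      then show "norm (proj (F m) x - proj (F n) x) < e"
        using *[of m n] *[of n m] by (cases "m \<le> n") (auto simp: norm_minus_commute)
    qed
  qed
  then obtain p where p: "(\<lambda>n. proj (F n) x) \<longlonglongrightarrow> p"
    by (auto simp: Cauchy_convergent_iff convergent_def)
  have "(x - p) \<bullet> e = 0" if e: "e \<in> E" for e
  proof -
    obtain K where "inverse (real (Suc K)) < lam e"
      using reals_Archimedean[OF lam_pos[OF e]] by blast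
    then have "e \<in> F K" using e by (simp add: F_def)
    then have "\<forall>n\<ge>K. (x - proj (F n) x) \<bullet> e = 0"
      using mono proj_inner[OF F e] by (auto simp: inner_diff_left)
    then have "(\<lambda>n. (x - proj (F n) x) \<bullet> e) \<longlonglongrightarrow> 0"
      by (intro tendsto_eventually eventually_sequentiallyI) auto
    moreover have "(\<lambda>n. (x - proj (F n) x) \<bullet> e) \<longlonglongrightarrow> (x - p) \<bullet> e"
      by (intro tendsto_intros p)
    ultimately show ?thesis by (metis LIMSEQ_unique)
  qed
  then have "x - p = 0" by (rule E_complete)
  then have "(\<lambda>n. proj (F n) x) \<longlonglongrightarrow> x" using p by simp
  then obtain n where "norm (proj (F n) x - x) < \<delta>"
    using LIMSEQ_D[OF _ \<delta>] by blast
  then show ?thesis using that[OF F] by (simp add: norm_minus_commute)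
qed

section \<open>Disintegration along an eigenvector\<close>

definition normal_law :: "'a \<Rightarrow> real measure" where
  "normal_law e = density lborel (\<lambda>t. ennreal (normal_density 0 (sqrt (lam e)) t))"

lemma prob_space_normal_law: "e \<in> E \<Longrightarrow> prob_space (normal_law e)"
  unfolding normal_law_def by (rule prob_space_normal_density) (simp add: lam_pos)

lemma sets_normal_law [measurable_cong]: "sets (normal_law e) = sets borel"
  by (simp add: normal_law_def)

text \<open>Resampling the \<open>e\<close>-coordinate independently preserves the law. Since
  \<open>e\<close> is an eigenvector, removing the component \<open>c\<close> of \<open>k\<close>
  along \<open>e\<close> splits the covariance form as
  \<open>S k' \<bullet> k' + lam e * c\<^sup>2\<close>, so the characteristic function factorises
  accordingly.\<close>

lemma disintegration:
  assumes e: "e \<in> E"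
  shows "distr (M \<Otimes>\<^sub>M normal_law e) borel (\<lambda>(y, t). y - (e \<bullet> y) *\<^sub>R e + t *\<^sub>R e) = M" (is "distr ?P _ ?f = _")
proof -
  interpret N: prob_space "normal_law e" using e by (rule prob_space_normal_law)
  interpret P: pair_prob_space M "normal_law e" ..
  have [measurable]: "fst \<in> borel_measurable ?P"
    using measurable_fst[of M "normal_law e"] by (simp add: measurable_cong_sets[OF refl sets_M])
  have f[measurable]: "?f \<in> borel_measurable ?P"
    unfolding split_beta by measurable
  have key: "(\<integral>z. cos (k \<bullet> ?f z) \<partial>?P) = exp (- (S k \<bullet> k) / 2) \<and> (\<integral>z. sin (k \<bullet> ?f z) \<partial>?P) = 0" for k
  proof -
    define c where "c = k \<bullet> e"
    define k' where "k' = k - c *\<^sub>R e"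
    have kf: "k \<bullet> (y - (e \<bullet> y) *\<^sub>R e + t *\<^sub>R e) = k' \<bullet> y + c * t" for y t
      by (simp add: k'_def c_def inner_add_right inner_diff_right inner_diff_left algebra_simps)
    have iN: "integrable (normal_law e) (\<lambda>t. cos (c * t))" "integrable (normal_law e) (\<lambda>t. sin (c * t))"
      by (rule N.integrable_const_bound[of _ 1]; simp)+
    have vN: "(\<integral>t. cos (c * t) \<partial>normal_law e) = exp (- (lam e * c\<^sup>2) / 2)" "(\<integral>t. sin (c * t) \<partial>normal_law e) = 0"
      using normal_trig_integrals[of "sqrt (lam e)" c] lam_pos[OF e]
      by (auto simp: normal_law_def power_mult_distrib)
    have "S k \<bullet> k = S k' \<bullet> k' + lam e * c\<^sup>2"
    proof -
      have Sk: "S k' = S k - (c * lam e) *\<^sub>R e"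
        unfolding k'_def by (simp add: linear_diff linear_scale bounded_linear.linear[OF bl] S_E[OF e])
      have "S k \<bullet> e = lam e * c" using e by (simp add: sym S_E c_def)
      moreover have "e \<bullet> k = c" by (simp add: c_def inner_commute)
      moreover have "e \<bullet> e = 1" using e by (simp add: inner_E)
      ultimately show ?thesis
        unfolding Sk by (simp add: k'_def inner_diff_left inner_diff_right power2_eq_square algebra_simps)
    qed
    then have ex: "exp (- (S k \<bullet> k) / 2) = exp (- (S k' \<bullet> k') / 2) * exp (- (lam e * c\<^sup>2) / 2)"
      by (simp flip: exp_add add: field_simps)
    have "(\<integral>z. cos (k \<bullet> ?f z) \<partial>?P) = (\<integral>y. \<integral>t. cos (k \<bullet> ?f (y, t)) \<partial>normal_law e \<partial>M)"
      by (subst P.integral_fst'[symmetric]) (auto intro!: P.integrable_const_bound[of _ 1])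
    also have "\<dots> = (\<integral>y. cos (k' \<bullet> y) * exp (- (lam e * c\<^sup>2) / 2) \<partial>M)"
      by (simp only: prod.case kf cos_add) (simp add: iN vN)
    also have "\<dots> = exp (- (S k \<bullet> k) / 2)"
      by (simp only: integral_mult_left_zero int_cos ex)
    finally have 1: "(\<integral>z. cos (k \<bullet> ?f z) \<partial>?P) = exp (- (S k \<bullet> k) / 2)" .
    have "(\<integral>z. sin (k \<bullet> ?f z) \<partial>?P) = (\<integral>y. \<integral>t. sin (k \<bullet> ?f (y, t)) \<partial>normal_law e \<partial>M)"
      by (subst P.integral_fst'[symmetric]) (auto intro!: P.integrable_const_bound[of _ 1])
    also have "\<dots> = (\<integral>y. sin (k' \<bullet> y) * exp (- (lam e * c\<^sup>2) / 2) \<partial>M)"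
      by (simp only: prod.case kf sin_add) (simp add: iN vN)
    also have "\<dots> = 0"
      by (simp only: integral_mult_left_zero int_sin mult_zero_left)
    finally show ?thesis using 1 by blast
  qed
  show ?thesis
  proof (rule measure_eq_if_trig_integrals_eq)
    show "prob_space (distr ?P borel ?f)" by (rule P.prob_space_distr[OF f])
    show "prob_space M" by (rule prob_space_axioms)
    show "(\<integral>x. cos (k \<bullet> x) \<partial>distr ?P borel ?f) = (\<integral>x. cos (k \<bullet> x) \<partial>M)" for k
      by (subst integral_distr[OF f]) (auto simp: key int_cos)
    show "(\<integral>x. sin (k \<bullet> x) \<partial>distr ?P borel ?f) = (\<integral>x. sin (k \<bullet> x) \<partial>M)" for k
      by (subst integral_distr[OF f]) (auto simp: key int_sin)
  qed (simp_all add: sets_M)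
qed

text \<open>This reduces ball estimates to lines parallel to \<open>e\<close>. The density is kept
  explicit so that weight and density can be treated as one function on the line.\<close>

lemma nn_integral_disintegration:
  assumes e: "e \<in> E" and g[measurable]: "g \<in> borel_measurable borel"
  shows "(\<integral>\<^sup>+u. g u \<partial>M) = (\<integral>\<^sup>+y. \<integral>\<^sup>+t. ennreal (normal_density 0 (sqrt (lam e)) t) * g (y - (e \<bullet> y) *\<^sub>R e + t *\<^sub>R e) \<partial>lborel \<partial>M)"
proof -
  interpret N: prob_space "normal_law e" using e by (rule prob_space_normal_law)
  interpret P: pair_prob_space M "normal_law e" ..
  have [measurable]: "fst \<in> borel_measurable (M \<Otimes>\<^sub>M normal_law e)"
    using measurable_fst[of M "normal_law e"] by (simp add: measurable_cong_sets[OF refl sets_M])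
  have f[measurable]: "(\<lambda>(y, t). y - (e \<bullet> y) *\<^sub>R e + t *\<^sub>R e) \<in> borel_measurable (M \<Otimes>\<^sub>M normal_law e)"
    unfolding split_beta by measurable
  have "(\<integral>\<^sup>+u. g u \<partial>M) = (\<integral>\<^sup>+u. g u \<partial>distr (M \<Otimes>\<^sub>M normal_law e) borel (\<lambda>(y, t). y - (e \<bullet> y) *\<^sub>R e + t *\<^sub>R e))"
    by (simp only: disintegration[OF e])
  also have "\<dots> = (\<integral>\<^sup>+z. g (case z of (y, t) \<Rightarrow> y - (e \<bullet> y) *\<^sub>R e + t *\<^sub>R e) \<partial>(M \<Otimes>\<^sub>M normal_law e))"
    by (rule nn_integral_distr[OF f]) simp
  also have "\<dots> = (\<integral>\<^sup>+y. \<integral>\<^sup>+t. g (y - (e \<bullet> y) *\<^sub>R e + t *\<^sub>R e) \<partial>normal_law e \<partial>M)"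
    by (subst N.nn_integral_fst[symmetric]) auto
  also have "\<dots> = (\<integral>\<^sup>+y. \<integral>\<^sup>+t. ennreal (normal_density 0 (sqrt (lam e)) t) * g (y - (e \<bullet> y) *\<^sub>R e + t *\<^sub>R e) \<partial>lborel \<partial>M)"
    unfolding normal_law_def by (subst nn_integral_density) auto
  finally show ?thesis .
qed

end

subsection \<open>Small balls of a Gaussian measure\<close>

lemma ennreal_double_le_imp_le: "a + a \<le> b + b \<Longrightarrow> a \<le> b" for a b :: ennreal
  using ennreal_mult_le_mult_iff[of 2 a b] by (simp add: mult_2)

lemma nn_integral_lborel_reflect:
  fixes g :: "real \<Rightarrow> ennreal"
  assumes "g \<in> borel_measurable borel"
  shows "(\<integral>\<^sup>+t. g t \<partial>lborel) = (\<integral>\<^sup>+t. g (s - t) \<partial>lborel)"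
  using nn_integral_real_affine[of g "- 1" s] assms by simp

text \<open>The one-dimensional case of Anderson's inequality. Reflecting at \<open>s / 2\<close> exchanges the two
  intervals, so that after symmetrising both integrals the integrands can be compared pointwise.\<close>

lemma nn_integral_interval_le_centered:
  fixes g :: "real \<Rightarrow> ennreal"
  assumes g[measurable]: "g \<in> borel_measurable borel"
    and mono: "\<And>s t. \<bar>s\<bar> \<le> \<bar>t\<bar> \<Longrightarrow> g t \<le> g s"
  shows "(\<integral>\<^sup>+t. indicator {t. (t - s)\<^sup>2 < c} t * g t \<partial>lborel) \<le> (\<integral>\<^sup>+t. indicator {t. t\<^sup>2 < c} t * g t \<partial>lborel)"
    (is "?L \<le> ?R")
proof -
  \<comment> \<open>Writing the intervals with squares covers the empty slice,
    \<open>c \<le> 0\<close>, without a case distinction.\<close>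
  let ?J = "{t. (t - s)\<^sup>2 < c}" and ?I = "{t::real. t\<^sup>2 < c}"
  have [measurable]: "?J \<in> sets borel" "?I \<in> sets borel"
    by measurable
  have L: "?L = (\<integral>\<^sup>+t. indicator ?I t * g (s - t) \<partial>lborel)"
    by (subst nn_integral_lborel_reflect[of _ s]) (auto intro!: nn_integral_cong simp: indicator_def)
  have R: "?R = (\<integral>\<^sup>+t. indicator ?J t * g (s - t) \<partial>lborel)"
    by (rule trans[OF nn_integral_lborel_reflect[of _ s]])
       (auto intro!: nn_integral_cong simp: indicator_def power2_commute[of s])
  have "?L + ?L = (\<integral>\<^sup>+t. indicator ?J t * g t + indicator ?I t * g (s - t) \<partial>lborel)"
    by (subst nn_integral_add) (auto simp flip: L)
  also have "\<dots> \<le> (\<integral>\<^sup>+t. indicator ?I t * g t + indicator ?J t * g (s - t) \<partial>lborel)"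
  proof (rule nn_integral_mono)
    fix t
    \<comment> \<open>The two sums differ only where \<open>t\<close> lies in exactly one of the
      intervals, and there \<open>t\<close> is nearer to the centre of that interval.\<close>
    have "g t \<le> g (s - t)" if "t \<in> ?J" "t \<notin> ?I"
    proof (rule mono)
      have "(s - t)\<^sup>2 \<le> t\<^sup>2" using that by (auto simp: power2_commute)
      then show "\<bar>s - t\<bar> \<le> \<bar>t\<bar>" by (simp add: abs_le_square_iff)
    qed
    moreover have "g (s - t) \<le> g t" if "t \<notin> ?J" "t \<in> ?I"
    proof (rule mono)
      have "t\<^sup>2 \<le> (s - t)\<^sup>2" using that by (auto simp: power2_commute)
      then show "\<bar>t\<bar> \<le> \<bar>s - t\<bar>" by (simp add: abs_le_square_iff)
    qed
    ultimately show "indicator ?J t * g t + indicator ?I t * g (s - t) \<le> indicator ?I t * g t + indicator ?J t * g (s - t)"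
      by (cases "t \<in> ?J"; cases "t \<in> ?I") (simp_all add: add.commute)
  qed
  also have "\<dots> = ?R + ?R"
    by (subst nn_integral_add) (auto simp flip: R)
  finally show ?thesis by (rule ennreal_double_le_imp_le)
qed

lemma exp_add_exp_minus_ge: "exp u + exp (- u) \<ge> (2::real)"
  using cosh_real_ge_1[of u] by (simp add: cosh_def)

text \<open>Centring the interval in two ways gives the densities at \<open>s - t\<close> and
  \<open>s + t\<close>. Their average is \<open>exp (- (s\<^sup>2 / (2 * \<sigma>\<^sup>2)))\<close>
  times the density at \<open>t\<close> times \<open>cosh (s * t / \<sigma>\<^sup>2)\<close>, and
  \<open>cosh\<close> is at least \<open>1\<close>.\<close>

lemma nn_integral_normal_shifted_ge:
  assumes \<sigma>: "\<sigma> > 0"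
  shows "ennreal (exp (- (s\<^sup>2 / (2 * \<sigma>\<^sup>2)))) * (\<integral>\<^sup>+t. indicator {t. t\<^sup>2 < c} t * ennreal (normal_density 0 \<sigma> t) \<partial>lborel)
     \<le> (\<integral>\<^sup>+t. indicator {t. (t - s)\<^sup>2 < c} t * ennreal (normal_density 0 \<sigma> t) \<partial>lborel)"
    (is "?e * ?L \<le> ?R")
proof -
  let ?n = "normal_density 0 \<sigma>"
  let ?J = "{t. (t - s)\<^sup>2 < c}" and ?I = "{t::real. t\<^sup>2 < c}"
  have [measurable]: "?J \<in> sets borel" "?I \<in> sets borel"
    by measurable
  have R1: "?R = (\<integral>\<^sup>+t. indicator ?I t * ennreal (?n (s - t)) \<partial>lborel)"
    by (subst nn_integral_lborel_reflect[of _ s]) (auto intro!: nn_integral_cong simp: indicator_def)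
  have R2: "?R = (\<integral>\<^sup>+t. indicator ?I t * ennreal (?n (s + t)) \<partial>lborel)"
    by (subst nn_integral_real_affine[of _ 1 s]) (auto intro!: nn_integral_cong simp: indicator_def)
  have pt: "2 * (exp (- (s\<^sup>2 / (2 * \<sigma>\<^sup>2))) * ?n t) \<le> ?n (s - t) + ?n (s + t)" for t
  proof -
    define u where "u = s * t / \<sigma>\<^sup>2"
    define k where "k = 1 / sqrt (2 * pi * \<sigma>\<^sup>2) * (exp (- (s\<^sup>2 / (2 * \<sigma>\<^sup>2))) * exp (- (t\<^sup>2 / (2 * \<sigma>\<^sup>2))))"
    have "?n (s - t) = k * exp u"
      using \<sigma> unfolding k_def u_def normal_density_def
      by (simp add: mult.assoc flip: exp_add) (simp add: field_simps power2_eq_square)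
    moreover have "?n (s + t) = k * exp (- u)"
      using \<sigma> unfolding k_def u_def normal_density_def
      by (simp add: mult.assoc flip: exp_add) (simp add: field_simps power2_eq_square)
    moreover have "exp (- (s\<^sup>2 / (2 * \<sigma>\<^sup>2))) * ?n t = k"
      by (simp add: k_def normal_density_def)
    moreover have "k * 2 \<le> k * (exp u + exp (- u))"
      by (intro mult_left_mono exp_add_exp_minus_ge) (simp add: k_def)
    ultimately show ?thesis by (simp add: distrib_left mult.commute)
  qed
  have "?e * ?L + ?e * ?L = (\<integral>\<^sup>+t. ?e * (indicator ?I t * ennreal (?n t)) + ?e * (indicator ?I t * ennreal (?n t)) \<partial>lborel)"
    by (subst nn_integral_add) (auto simp: nn_integral_cmult)
  also have "\<dots> \<le> (\<integral>\<^sup>+t. indicator ?I t * ennreal (?n (s - t)) + indicator ?I t * ennreal (?n (s + t)) \<partial>lborel)"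
  proof (rule nn_integral_mono)
    fix t
    have "?e * ennreal (?n t) + ?e * ennreal (?n t) = ennreal (2 * (exp (- (s\<^sup>2 / (2 * \<sigma>\<^sup>2))) * ?n t))"
      by (simp flip: ennreal_mult ennreal_plus)
    also have "\<dots> \<le> ennreal (?n (s - t)) + ennreal (?n (s + t))"
      using ennreal_leI[OF pt[of t]] by simp
    finally show "?e * (indicator ?I t * ennreal (?n t)) + ?e * (indicator ?I t * ennreal (?n t))
       \<le> indicator ?I t * ennreal (?n (s - t)) + indicator ?I t * ennreal (?n (s + t))"
      by (simp add: indicator_def)
  qed
  also have "\<dots> = ?R + ?R"
    by (subst nn_integral_add) (auto simp flip: R1 R2)
  finally show ?thesis by (rule ennreal_double_le_imp_le)
qed

section \<open>Ball estimates by slicing along eigenvectors\<close>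

context centered_gaussian
begin

text \<open>By Pythagoras the slice is an interval centred at \<open>x \<bullet> e\<close> whose
  length depends only on the components orthogonal to \<open>e\<close>. Changing the
  \<open>e\<close>-coordinate of the centre thus merely translates every slice.\<close>

lemma slice_ball:
  assumes e: "e \<in> E" and r: "r > 0"
  shows "y - (e \<bullet> y) *\<^sub>R e + t *\<^sub>R e \<in> ball x r
    \<longleftrightarrow> (t - x \<bullet> e)\<^sup>2 < r\<^sup>2 - (norm ((x - (x \<bullet> e) *\<^sub>R e) - (y - (e \<bullet> y) *\<^sub>R e)))\<^sup>2"
proof -
  let ?p = "(x - (x \<bullet> e) *\<^sub>R e) - (y - (e \<bullet> y) *\<^sub>R e)"
  have ee: "e \<bullet> e = 1" using e by (simp add: inner_E)
  have "?p \<bullet> e = 0"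
    using ee by (simp add: inner_diff_left inner_commute[of e y])
  then have "(norm (?p + (x \<bullet> e - t) *\<^sub>R e))\<^sup>2 = (norm ?p)\<^sup>2 + (norm ((x \<bullet> e - t) *\<^sub>R e))\<^sup>2"
    by (intro norm_add_Pythagorean) (simp add: orthogonal_def)
  also have "(norm ((x \<bullet> e - t) *\<^sub>R e))\<^sup>2 = (t - x \<bullet> e)\<^sup>2"
    using e by (simp add: power2_commute)
  also have "?p + (x \<bullet> e - t) *\<^sub>R e = x - (y - (e \<bullet> y) *\<^sub>R e + t *\<^sub>R e)"
    by (simp add: algebra_simps)
  finally have *: "(dist x (y - (e \<bullet> y) *\<^sub>R e + t *\<^sub>R e))\<^sup>2 = (norm ?p)\<^sup>2 + (t - x \<bullet> e)\<^sup>2"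
    by (simp add: dist_norm)
  have "dist x (y - (e \<bullet> y) *\<^sub>R e + t *\<^sub>R e) < r \<longleftrightarrow> (dist x (y - (e \<bullet> y) *\<^sub>R e + t *\<^sub>R e))\<^sup>2 < r\<^sup>2"
    using r by (metis power2_less_imp_less power_strict_mono zero_le_dist zero_less_numeral less_imp_le)
  then show ?thesis unfolding * by auto
qed

text \<open>The one-dimensional Anderson inequality, applied on every line parallel to
  \<open>e\<close> to the product of density and weight.\<close>

lemma weighted_ball_le_shifted:
  assumes e: "e \<in> E" and r: "r > 0" and w[measurable]: "w \<in> borel_measurable borel"
    and mono: "\<And>y s t. y \<bullet> e = 0 \<Longrightarrow> \<bar>s\<bar> \<le> \<bar>t\<bar> \<Longrightarrow>
      ennreal (normal_density 0 (sqrt (lam e)) t) * w (y + t *\<^sub>R e) \<le> ennreal (normal_density 0 (sqrt (lam e)) s) * w (y + s *\<^sub>R e)"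
  shows "(\<integral>\<^sup>+u. indicator (ball x r) u * w u \<partial>M) \<le> (\<integral>\<^sup>+u. indicator (ball (x - (x \<bullet> e) *\<^sub>R e) r) u * w u \<partial>M)"
proof -
  let ?n = "normal_density 0 (sqrt (lam e))"
  let ?x = "x - (x \<bullet> e) *\<^sub>R e"
  have ee: "e \<bullet> e = 1" using e by (simp add: inner_E)
  have x0: "?x \<bullet> e = 0" using ee by (simp add: inner_diff_left)
  have "(\<integral>\<^sup>+t. ennreal (?n t) * (indicator (ball x r) (y - (e \<bullet> y) *\<^sub>R e + t *\<^sub>R e) * w (y - (e \<bullet> y) *\<^sub>R e + t *\<^sub>R e)) \<partial>lborel)
     \<le> (\<integral>\<^sup>+t. ennreal (?n t) * (indicator (ball ?x r) (y - (e \<bullet> y) *\<^sub>R e + t *\<^sub>R e) * w (y - (e \<bullet> y) *\<^sub>R e + t *\<^sub>R e)) \<partial>lborel)"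
    (is "?L \<le> ?R") for y
  proof -
    let ?y = "y - (e \<bullet> y) *\<^sub>R e"
    define c where "c = r\<^sup>2 - (norm (?x - ?y))\<^sup>2"
    have "?L = (\<integral>\<^sup>+t. indicator {t. (t - x \<bullet> e)\<^sup>2 < c} t * (ennreal (?n t) * w (?y + t *\<^sub>R e)) \<partial>lborel)"
      using slice_ball[OF e r, of y _ x] by (intro nn_integral_cong) (auto simp: indicator_def c_def)
    also have "\<dots> \<le> (\<integral>\<^sup>+t. indicator {t. t\<^sup>2 < c} t * (ennreal (?n t) * w (?y + t *\<^sub>R e)) \<partial>lborel)"
    proof (rule nn_integral_interval_le_centered)
      have "?y \<bullet> e = 0" using ee by (simp add: inner_diff_left inner_commute[of e y])
      then show "ennreal (?n t) * w (?y + t *\<^sub>R e) \<le> ennreal (?n s) * w (?y + s *\<^sub>R e)" if "\<bar>s\<bar> \<le> \<bar>t\<bar>" for s t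
        using that by (rule mono)
    qed measurable
    also have "\<dots> = ?R"
      using slice_ball[OF e r, of y _ ?x] x0 by (intro nn_integral_cong) (auto simp: indicator_def c_def)
    finally show ?thesis .
  qed
  moreover have [measurable]: "ball z r \<in> sets borel" for z :: 'a
    by simp
  ultimately show ?thesis
    by (subst (1 2) nn_integral_disintegration[OF e]) (measurable, rule nn_integral_mono)
qed

text \<open>Giving the centre the coordinate \<open>s\<close> along \<open>e\<close> costs at most
  its Cameron--Martin contribution, slice by slice.\<close>

lemma emeasure_ball_shift_ge:
  assumes e: "e \<in> E" and r: "r > 0" and x: "x \<bullet> e = 0"
  shows "ennreal (exp (- (s\<^sup>2 / (2 * lam e)))) * emeasure M (ball x r) \<le> emeasure M (ball (x + s *\<^sub>R e) r)"
proof -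
  let ?n = "normal_density 0 (sqrt (lam e))"
  let ?x = "x + s *\<^sub>R e"
  have ee: "e \<bullet> e = 1" using e by (simp add: inner_E)
  have xe: "?x \<bullet> e = s" using ee x by (simp add: inner_add_left)
  have [measurable]: "ball z r \<in> sets borel" for z :: 'a
    by simp
  have em: "emeasure M (ball z r) = (\<integral>\<^sup>+y. \<integral>\<^sup>+t. ennreal (?n t) * indicator (ball z r) (y - (e \<bullet> y) *\<^sub>R e + t *\<^sub>R e) \<partial>lborel \<partial>M)" for z
    by (subst nn_integral_disintegration[OF e, symmetric]) (auto simp: sets_M intro!: borel_measurable_indicator)
  have "ennreal (exp (- (s\<^sup>2 / (2 * lam e)))) * (\<integral>\<^sup>+t. ennreal (?n t) * indicator (ball x r) (y - (e \<bullet> y) *\<^sub>R e + t *\<^sub>R e) \<partial>lborel)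
     \<le> (\<integral>\<^sup>+t. ennreal (?n t) * indicator (ball ?x r) (y - (e \<bullet> y) *\<^sub>R e + t *\<^sub>R e) \<partial>lborel)"
    (is "_ * ?L \<le> ?R") for y
  proof -
    let ?y = "y - (e \<bullet> y) *\<^sub>R e"
    define c where "c = r\<^sup>2 - (norm (x - ?y))\<^sup>2"
    have L: "?L = (\<integral>\<^sup>+t. indicator {t. t\<^sup>2 < c} t * ennreal (?n t) \<partial>lborel)"
      using slice_ball[OF e r, of y _ x] x by (intro nn_integral_cong) (auto simp: indicator_def c_def)
    have R: "?R = (\<integral>\<^sup>+t. indicator {t. (t - s)\<^sup>2 < c} t * ennreal (?n t) \<partial>lborel)"
      using slice_ball[OF e r, of y _ ?x] xe by (intro nn_integral_cong) (auto simp: indicator_def c_def)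
    show ?thesis
      unfolding L R using nn_integral_normal_shifted_ge[of "sqrt (lam e)" s c] lam_pos[OF e] by simp
  qed
  then show ?thesis
    unfolding em by (subst nn_integral_cmult[symmetric]) (measurable, rule nn_integral_mono)
qed

text \<open>A bounded quadratic form with eigenvalue \<open>1 / lam e\<close> at \<open>e \<in> F\<close> and \<open>a\<close> on the orthogonal complement
  of \<open>F\<close>. It lies below the squared Cameron--Martin norm if \<open>a * lam e \<le> 1\<close> for all \<open>e\<close> outside \<open>F\<close>.\<close>

definition Q :: "'a set \<Rightarrow> real \<Rightarrow> 'a \<Rightarrow> real" where
  "Q F a u = a * (norm u)\<^sup>2 + (\<Sum>f\<in>F. (1 / lam f - a) * (u \<bullet> f)\<^sup>2)"

lemma Q_eq:
  "Q F a u = a * ((norm u)\<^sup>2 - (\<Sum>f\<in>F. (u \<bullet> f)\<^sup>2)) + (\<Sum>f\<in>F. (u \<bullet> f)\<^sup>2 / lam f)"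
  by (simp add: Q_def left_diff_distrib sum_subtractf sum_distrib_left right_diff_distrib)

lemma Q_eq_diff_proj:
  assumes "finite F" "F \<subseteq> E" "0 \<le> a"
  shows "a * (norm (u - proj F u))\<^sup>2 + (\<Sum>f\<in>F. (u \<bullet> f)\<^sup>2 / lam f) = Q F a u"
  using norm_diff_proj[OF assms(1,2)] by (simp add: Q_eq)

lemma sum_inner_div_lam_nonneg:
  assumes "F \<subseteq> E"
  shows "0 \<le> (\<Sum>f\<in>F. (u \<bullet> f)\<^sup>2 / lam f)"
  using assms lam_pos by (intro sum_nonneg divide_nonneg_nonneg) (auto intro: less_imp_le)

text \<open>A crude bound for the operator norm of the form; being finite is enough, as it always
  appears multiplied by the square of a radius that tends to \<open>0\<close>.\<close>

definition Q_bound :: "'a set \<Rightarrow> real \<Rightarrow> real" where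
  "Q_bound F a = a + (\<Sum>f\<in>F. 1 / lam f)"

lemma Q_le:
  assumes "F \<subseteq> E" "0 \<le> a"
  shows "Q F a u \<le> Q_bound F a * (norm u)\<^sup>2"
proof -
  have "(\<Sum>f\<in>F. (1 / lam f - a) * (u \<bullet> f)\<^sup>2) \<le> (\<Sum>f\<in>F. 1 / lam f * (norm u)\<^sup>2)"
  proof (rule sum_mono)
    fix f assume "f \<in> F"
    then have f: "f \<in> E" using assms by auto
    have "\<bar>u \<bullet> f\<bar> \<le> norm u" using Cauchy_Schwarz_ineq2[of u f] f by simp
    then have "(u \<bullet> f)\<^sup>2 \<le> (norm u)\<^sup>2" using power_mono[of "\<bar>u \<bullet> f\<bar>" "norm u" 2] by simp
    moreover have "1 / lam f - a \<le> 1 / lam f" using assms by simp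
    ultimately show "(1 / lam f - a) * (u \<bullet> f)\<^sup>2 \<le> 1 / lam f * (norm u)\<^sup>2"
      using lam_pos[OF f] by (intro mult_mono) auto
  qed
  then show ?thesis by (simp add: Q_def Q_bound_def distrib_right sum_distrib_right)
qed

lemma continuous_Q: "continuous_on UNIV (Q F a)"
  unfolding Q_def by (intro continuous_intros)

lemma Q_split:
  assumes F: "finite F" "F \<subseteq> E" and e: "e \<in> E" and y: "y \<bullet> e = 0"
  shows "Q F a (y + t *\<^sub>R e) = Q F a y + (if e \<in> F then 1 / lam e else a) * t\<^sup>2"
proof -
  have n: "(norm (y + t *\<^sub>R e))\<^sup>2 = (norm y)\<^sup>2 + t\<^sup>2"
    using norm_add_Pythagorean[of y "t *\<^sub>R e"] y e by (simp add: orthogonal_def)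
  have "(\<Sum>f\<in>F. (1 / lam f - a) * ((y + t *\<^sub>R e) \<bullet> f)\<^sup>2)
    = (\<Sum>f\<in>F. (1 / lam f - a) * (y \<bullet> f)\<^sup>2 + (if e = f then (1 / lam e - a) * t\<^sup>2 else 0))"
  proof (rule sum.cong[OF refl])
    fix f assume "f \<in> F"
    then have "f \<in> E" using F by auto
    then show "(1 / lam f - a) * ((y + t *\<^sub>R e) \<bullet> f)\<^sup>2 = (1 / lam f - a) * (y \<bullet> f)\<^sup>2 + (if e = f then (1 / lam e - a) * t\<^sup>2 else 0)"
      using e y by (auto simp: inner_add_left inner_E)
  qed
  also have "\<dots> = (\<Sum>f\<in>F. (1 / lam f - a) * (y \<bullet> f)\<^sup>2) + (if e \<in> F then (1 / lam e - a) * t\<^sup>2 else 0)"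
    using F by (simp add: sum.distrib)
  finally show ?thesis
    by (simp add: Q_def n algebra_simps)
qed

text \<open>The mass of a ball under \<open>exp (Q F a / 2)\<close> times \<open>M\<close>; extended
  values avoid any integrability question for this growing weight.\<close>

definition J :: "'a set \<Rightarrow> real \<Rightarrow> 'a \<Rightarrow> real \<Rightarrow> ennreal" where
  "J F a x r = (\<integral>\<^sup>+u. indicator (ball x r) u * ennreal (exp (Q F a u / 2)) \<partial>M)"

text \<open>On a line along \<open>e\<close>, density times weight is a constant times
  \<open>exp ((b - 1 / lam e) * t\<^sup>2 / 2)\<close>, where \<open>b\<close> is the eigenvalue of
  the form at \<open>e\<close>. The condition on \<open>a\<close> gives
  \<open>b \<le> 1 / lam e\<close>, hence monotonicity in \<open>\<bar>t\<bar>\<close>.\<close>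

lemma J_le_shifted:
  assumes F: "finite F" "F \<subseteq> E" and a: "\<And>e. e \<in> E - F \<Longrightarrow> a * lam e \<le> 1"
    and e: "e \<in> E" and r: "r > 0"
  shows "J F a x r \<le> J F a (x - (x \<bullet> e) *\<^sub>R e) r"
  unfolding J_def
proof (rule weighted_ball_le_shifted[OF e r])
  show "(\<lambda>u. ennreal (exp (Q F a u / 2))) \<in> borel_measurable borel"
    using borel_measurable_continuous_onI[OF continuous_Q[of F a]] by measurable
  fix y and s t :: real assume y: "y \<bullet> e = 0" and st: "\<bar>s\<bar> \<le> \<bar>t\<bar>"
  define b where "b = (if e \<in> F then 1 / lam e else a)"
  have l: "lam e > 0" using e by (rule lam_pos)
  have b: "b \<le> 1 / lam e"
    using a[of e] e l by (auto simp: b_def field_simps)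
  have *: "normal_density 0 (sqrt (lam e)) t * exp (Q F a (y + t *\<^sub>R e) / 2)
     = exp (Q F a y / 2) / sqrt (2 * pi * lam e) * exp ((b - 1 / lam e) * t\<^sup>2 / 2)" for t
  proof -
    have "exp (- t\<^sup>2 / (2 * lam e)) * exp ((Q F a y + b * t\<^sup>2) / 2) = exp (Q F a y / 2) * exp ((b - 1 / lam e) * t\<^sup>2 / 2)"
      using l by (simp flip: exp_add) (simp add: field_simps)
    then show ?thesis
      using l by (simp add: Q_split[OF F e y] b_def[symmetric] normal_density_def)
  qed
  have "s\<^sup>2 \<le> t\<^sup>2" using st by (simp add: abs_le_square_iff)
  then have "(b - 1 / lam e) * t\<^sup>2 \<le> (b - 1 / lam e) * s\<^sup>2"
    using b by (intro mult_left_mono_neg) auto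
  then have "normal_density 0 (sqrt (lam e)) t * exp (Q F a (y + t *\<^sub>R e) / 2) \<le> normal_density 0 (sqrt (lam e)) s * exp (Q F a (y + s *\<^sub>R e) / 2)"
    unfolding * using l by (intro mult_left_mono) auto
  then show "ennreal (normal_density 0 (sqrt (lam e)) t) * ennreal (exp (Q F a (y + t *\<^sub>R e) / 2))
    \<le> ennreal (normal_density 0 (sqrt (lam e)) s) * ennreal (exp (Q F a (y + s *\<^sub>R e) / 2))"
    by (simp add: ennreal_leI flip: ennreal_mult)
qed

lemma J_le_diff_proj:
  assumes F: "finite F" "F \<subseteq> E" and a: "\<And>e. e \<in> E - F \<Longrightarrow> a * lam e \<le> 1"
    and G: "finite G" "G \<subseteq> E" and r: "r > 0"
  shows "J F a x r \<le> J F a (x - proj G x) r"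
  using G
proof (induction G rule: finite_induct)
  case (insert e G)
  let ?z = "x - proj G x"
  have ze: "?z \<bullet> e = x \<bullet> e"
    using insert proj_inner[of G e x] by (simp add: inner_diff_left)
  have "J F a x r \<le> J F a ?z r" using insert by auto
  also have "\<dots> \<le> J F a (?z - (?z \<bullet> e) *\<^sub>R e) r"
    using insert by (intro J_le_shifted F a r) auto
  also have "?z - (?z \<bullet> e) *\<^sub>R e = x - proj (insert e G) x"
    unfolding ze using insert by (simp add: proj_def)
  finally show ?case .
qed (simp add: proj_def)

text \<open>On the left the weight is at least \<open>exp (m / 2)\<close>, near the origin it is at
  most \<open>exp (Q_bound F a * r\<^sup>2 / 2)\<close>, and between the two the weighted mass only
  grows when coordinates of the centre are removed. Finitely many removals bring the centre close to
  \<open>0\<close> but not onto it, so a smaller radius \<open>r'\<close> is used and sent to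
  \<open>r\<close>.\<close>

lemma ball_measure_le:
  assumes F: "finite F" "F \<subseteq> E" and a: "a \<ge> 0" "\<And>e. e \<in> E - F \<Longrightarrow> a * lam e \<le> 1"
    and r: "r > 0" and m: "\<And>u. u \<in> ball x r \<Longrightarrow> m \<le> Q F a u"
  shows "exp (m / 2) * measure M (ball x r) \<le> exp (Q_bound F a * r\<^sup>2 / 2) * measure M (ball 0 r)"
proof -
  have [simp]: "ball z s \<in> sets M" for z s by (simp add: sets_M)
  have inner: "exp (m / 2) * measure M (ball x r') \<le> exp (Q_bound F a * r\<^sup>2 / 2) * measure M (ball 0 r)"
    if r': "0 < r'" "r' < r" for r'
  proof -
    obtain G where G: "finite G" "G \<subseteq> E" "norm (x - proj G x) < r - r'"
      using proj_approx[of "r - r'" x] r' by auto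
    let ?z = "x - proj G x"
    have "ennreal (exp (m / 2)) * emeasure M (ball x r') = (\<integral>\<^sup>+u. ennreal (exp (m / 2)) * indicator (ball x r') u \<partial>M)"
      by (simp add: nn_integral_cmult_indicator)
    also have "\<dots> \<le> J F a x r'"
      unfolding J_def using m r' by (intro nn_integral_mono) (auto simp: indicator_def intro!: ennreal_leI)
    also have "\<dots> \<le> J F a ?z r'"
      by (rule J_le_diff_proj[OF F a(2) G(1,2) r'(1)])
    also have "\<dots> \<le> (\<integral>\<^sup>+u. ennreal (exp (Q_bound F a * r\<^sup>2 / 2)) * indicator (ball 0 r) u \<partial>M)"
      unfolding J_def
    proof (rule nn_integral_mono)
      fix u
      show "indicator (ball ?z r') u * ennreal (exp (Q F a u / 2)) \<le> ennreal (exp (Q_bound F a * r\<^sup>2 / 2)) * indicator (ball 0 r) u"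
      proof (cases "u \<in> ball ?z r'")
        case True
        then have nu: "norm u < r"
          using G(3) norm_triangle_ineq[of ?z "u - ?z"] by (auto simp: dist_norm norm_minus_commute)
        have "Q_bound F a \<ge> 0"
          unfolding Q_bound_def using a(1) F lam_pos by (intro add_nonneg_nonneg sum_nonneg) (auto intro: less_imp_le)
        then have "Q_bound F a * (norm u)\<^sup>2 \<le> Q_bound F a * r\<^sup>2"
          using nu by (intro mult_left_mono power_mono) auto
        then have "Q F a u \<le> Q_bound F a * r\<^sup>2"
          using Q_le[OF F(2) a(1), of u] by linarith
        then show ?thesis
          using True nu by (auto simp: indicator_def intro!: ennreal_leI)
      qed simp
    qed
    also have "\<dots> = ennreal (exp (Q_bound F a * r\<^sup>2 / 2)) * emeasure M (ball 0 r)"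
      by (simp add: nn_integral_cmult_indicator)
    finally show ?thesis
      by (simp add: emeasure_eq_measure flip: ennreal_mult)
  qed
  \<comment> \<open>With \<open>n + 2\<close> the radii are positive already at
    \<open>n = 0\<close>; they increase to \<open>r\<close>.\<close>
  define B' where "B' n = ball x (r - r / real (n + 2))" for n
  have lim: "(\<lambda>n. measure M (B' n)) \<longlonglongrightarrow> measure M (\<Union>n. B' n)"
  proof (rule finite_Lim_measure_incseq)
    show "incseq B'"
    proof (rule incseq_SucI)
      fix n
      have "r / real (Suc n + 2) \<le> r / real (n + 2)"
        using r by (intro divide_left_mono) auto
      then show "B' n \<subseteq> B' (Suc n)"
        unfolding B'_def by (intro subset_ball) linarith
    qed
  qed (auto simp: B'_def)
  have "(\<Union>n. B' n) = ball x r"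
  proof (intro set_eqI iffI)
    fix u assume "u \<in> ball x r"
    then have "0 < (r - dist x u) / r" using r by simp
    then obtain n where n: "inverse (real (Suc n)) < (r - dist x u) / r"
      using reals_Archimedean by blast
    have "r / real (n + 2) \<le> r * inverse (real (Suc n))"
      using r by (simp add: field_simps)
    also have "\<dots> < r * ((r - dist x u) / r)"
      using n r by (intro mult_strict_left_mono)
    also have "\<dots> = r - dist x u" using r by simp
    finally show "u \<in> (\<Union>n. B' n)"
      by (intro UN_I[of n]) (auto simp: B'_def)
  next
    fix u assume "u \<in> (\<Union>n. B' n)"
    then obtain n where "dist x u < r - r / real (n + 2)" by (auto simp: B'_def)
    moreover have "r / real (n + 2) > 0" using r by simp
    ultimately show "u \<in> ball x r" by simp
  qed
  with lim have "(\<lambda>n. exp (m / 2) * measure M (B' n)) \<longlonglongrightarrow> exp (m / 2) * measure M (ball x r)"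
    by (intro tendsto_intros) simp
  then show ?thesis
  proof (rule LIMSEQ_le_const2)
    have "exp (m / 2) * measure M (B' n) \<le> exp (Q_bound F a * r\<^sup>2 / 2) * measure M (ball 0 r)" for n
      unfolding B'_def by (rule inner) (use r in \<open>auto simp: field_simps intro!: add_pos_nonneg\<close>)
    then show "\<exists>N. \<forall>n\<ge>N. exp (m / 2) * measure M (B' n) \<le> exp (Q_bound F a * r\<^sup>2 / 2) * measure M (ball 0 r)"
      by blast
  qed
qed

text \<open>The coordinates of \<open>proj F z\<close> are added one by one; each shift starts from
  a centre orthogonal to the new eigenvector.\<close>

lemma ball_measure_ge:
  assumes F: "finite F" "F \<subseteq> E" and r: "r > 0"
  shows "exp (- (\<Sum>f\<in>F. (z \<bullet> f)\<^sup>2 / lam f) / 2) * measure M (ball 0 r) \<le> measure M (ball (proj F z) r)"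
  using F
proof (induction F rule: finite_induct)
  case (insert e F)
  have pe: "proj F z \<bullet> e = 0"
    using insert proj_inner[of F e z] by simp
  have e: "e \<in> E" using insert by simp
  let ?s = "(z \<bullet> e)\<^sup>2 / (2 * lam e)"
  have "exp (- (\<Sum>f\<in>insert e F. (z \<bullet> f)\<^sup>2 / lam f) / 2) = exp (- ?s) * exp (- (\<Sum>f\<in>F. (z \<bullet> f)\<^sup>2 / lam f) / 2)"
    using insert(1,2) by (simp flip: exp_add add: add_divide_distrib)
  then have "exp (- (\<Sum>f\<in>insert e F. (z \<bullet> f)\<^sup>2 / lam f) / 2) * measure M (ball 0 r) \<le> exp (- ?s) * measure M (ball (proj F z) r)"
    using insert by (simp add: mult.assoc)
  also have "\<dots> \<le> measure M (ball (proj F z + (z \<bullet> e) *\<^sub>R e) r)"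
    using emeasure_ball_shift_ge[OF e r pe, of "z \<bullet> e"]
    by (simp add: emeasure_eq_measure flip: ennreal_mult)
  also have "proj F z + (z \<bullet> e) *\<^sub>R e = proj (insert e F) z"
    using insert(1,2) by (simp add: proj_def)
  finally show ?case .
qed (simp add: proj_def)

end

subsection \<open>Modes\<close>

text \<open>For small radii the supremum is at most \<open>\<kappa>\<close> times the ball at
  \<open>x\<close>, for any \<open>\<kappa> > 1\<close>, and it dominates the ball at every
  \<open>z\<close>. The ratio being positive also rules out null balls at \<open>x\<close>, because
  division by zero yields \<open>0\<close>.\<close>

lemma strong_mode_imp_weak_mode:
  fixes \<nu> :: "'a::metric_space measure"
  assumes "prob_space \<nu>" and sets: "sets \<nu> = sets borel" and strong: "strong_mode \<nu> x"
  shows "weak_mode \<nu> x"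
proof -
  interpret prob_space \<nu> by fact
  define s where "s \<epsilon> = (SUP z. measure \<nu> (ball z \<epsilon>))" for \<epsilon>
  have le_s: "measure \<nu> (ball z \<epsilon>) \<le> s \<epsilon>" for z \<epsilon>
    unfolding s_def by (rule cSUP_upper) (auto intro!: bdd_aboveI[of _ 1])
  have lim: "((\<lambda>\<epsilon>. measure \<nu> (ball x \<epsilon>) / s \<epsilon>) \<longlongrightarrow> 1) (at_right 0)"
    using strong by (simp add: strong_mode_def s_def)
  have ratio: "measure \<nu> (ball x \<epsilon>) > 0 \<and> measure \<nu> (ball z \<epsilon>) / measure \<nu> (ball x \<epsilon>) < \<kappa>"
    if "inverse \<kappa> < measure \<nu> (ball x \<epsilon>) / s \<epsilon>" "\<kappa> > 0" for \<epsilon> \<kappa> z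
  proof -
    have "0 < measure \<nu> (ball x \<epsilon>) / s \<epsilon>"
      using that by (meson order_less_trans positive_imp_inverse_positive)
    moreover have "0 \<le> measure \<nu> (ball x \<epsilon>)" by simp
    ultimately have pos: "0 < measure \<nu> (ball x \<epsilon>)" "0 < s \<epsilon>"
      by (auto simp: zero_less_divide_iff)
    have "measure \<nu> (ball z \<epsilon>) \<le> s \<epsilon>" by (rule le_s)
    also have "s \<epsilon> < \<kappa> * measure \<nu> (ball x \<epsilon>)"
      using that pos by (simp add: field_simps)
    finally show ?thesis using pos by (simp add: field_simps)
  qed
  have ev: "eventually (\<lambda>\<epsilon>. measure \<nu> (ball x \<epsilon>) > 0 \<and> measure \<nu> (ball z \<epsilon>) / measure \<nu> (ball x \<epsilon>) < \<kappa>) (at_right 0)"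
    if "\<kappa> > 1" for \<kappa> z
  proof -
    have "eventually (\<lambda>\<epsilon>. inverse \<kappa> < measure \<nu> (ball x \<epsilon>) / s \<epsilon>) (at_right 0)"
      using that by (intro order_tendstoD[OF lim]) (simp add: inverse_less_1_iff)
    then show ?thesis
      by eventually_elim (use ratio that in auto)
  qed
  have "measure \<nu> (ball x \<epsilon>) > 0" if "\<epsilon> > 0" for \<epsilon>
  proof -
    obtain b where b: "b > 0" "\<And>t. 0 < t \<Longrightarrow> t < b \<Longrightarrow> measure \<nu> (ball x t) > 0"
      using ev[of 2 x] unfolding eventually_at_right_field by auto
    define t where "t = min \<epsilon> b / 2"
    have "0 < measure \<nu> (ball x t)" using b that by (auto simp: t_def)
    also have "\<dots> \<le> measure \<nu> (ball x \<epsilon>)"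
      using that b by (intro finite_measure_mono subset_ball) (auto simp: t_def sets)
    finally show ?thesis .
  qed
  moreover have "Limsup (at_right 0) (\<lambda>\<epsilon>. ereal (measure \<nu> (ball z \<epsilon>) / measure \<nu> (ball x \<epsilon>))) \<le> 1" for z
    unfolding Limsup_le_iff
  proof (intro allI impI)
    fix y :: ereal assume "1 < y"
    then obtain \<kappa> where \<kappa>: "1 < ereal \<kappa>" "ereal \<kappa> < y"
      using ereal_dense2 by blast
    then have "1 < \<kappa>" by simp
    from ev[OF this, of z] show "eventually (\<lambda>\<epsilon>. ereal (measure \<nu> (ball z \<epsilon>) / measure \<nu> (ball x \<epsilon>)) < y) (at_right 0)"
    proof eventually_elim
      case (elim \<epsilon>)
      then have "ereal (measure \<nu> (ball z \<epsilon>) / measure \<nu> (ball x \<epsilon>)) < ereal \<kappa>" by simp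
      then show ?case using \<kappa>(2) by (rule less_trans)
    qed
  qed
  ultimately show ?thesis
    by (simp add: weak_mode_def measure_support_def)
qed

lemma weak_not_strong_modeE:
  fixes \<nu> :: "'a::metric_space measure"
  assumes "prob_space \<nu>" and weak: "weak_mode \<nu> x" and not_strong: "\<not> strong_mode \<nu> x"
  obtains c \<epsilon> y where "0 < c" "c < 1" "\<And>n. 0 < \<epsilon> n" "\<epsilon> \<longlonglongrightarrow> 0"
    "\<And>n. 0 < measure \<nu> (ball x (\<epsilon> n))"
    "\<And>z. eventually (\<lambda>n. measure \<nu> (ball z (\<epsilon> n)) \<le> c * measure \<nu> (ball (y n) (\<epsilon> n))) sequentially"
    "\<And>n. 0 < measure \<nu> (ball (y n) (\<epsilon> n))"
proof -
  interpret prob_space \<nu> by fact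
  define s where "s \<epsilon> = (SUP z. measure \<nu> (ball z \<epsilon>))" for \<epsilon>
  have bdd: "bdd_above (range (\<lambda>z. measure \<nu> (ball z \<epsilon>)))" for \<epsilon>
    by (auto intro!: bdd_aboveI[of _ 1])
  have le_s: "measure \<nu> (ball z \<epsilon>) \<le> s \<epsilon>" for z \<epsilon>
    unfolding s_def by (rule cSUP_upper) (auto intro!: bdd)
  have pos: "0 < measure \<nu> (ball x \<epsilon>)" if "\<epsilon> > 0" for \<epsilon>
    using weak that by (simp add: weak_mode_def measure_support_def)
  have s_pos: "0 < s \<epsilon>" if "\<epsilon> > 0" for \<epsilon>
    using pos[OF that] le_s[of x \<epsilon>] by linarith
  \<comment> \<open>The ratio never exceeds \<open>1\<close>, so only its lower bound can
    fail.\<close>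
  have "\<exists>a<1. \<not> eventually (\<lambda>\<epsilon>. a < measure \<nu> (ball x \<epsilon>) / s \<epsilon>) (at_right 0)"
  proof (rule ccontr)
    assume "\<not> ?thesis"
    then have lower: "eventually (\<lambda>\<epsilon>. a < measure \<nu> (ball x \<epsilon>) / s \<epsilon>) (at_right 0)" if "a < 1" for a
      using that by blast
    have "((\<lambda>\<epsilon>. measure \<nu> (ball x \<epsilon>) / s \<epsilon>) \<longlongrightarrow> 1) (at_right 0)"
    proof (rule order_tendstoI[OF lower])
      fix a :: real assume "1 < a"
      have "measure \<nu> (ball x \<epsilon>) / s \<epsilon> \<le> 1" for \<epsilon>
        using le_s[of x \<epsilon>] order_trans[OF measure_nonneg le_s[of x \<epsilon>]] by (auto simp: divide_le_eq_1)
      then show "eventually (\<lambda>\<epsilon>. measure \<nu> (ball x \<epsilon>) / s \<epsilon> < a) (at_right 0)"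
        using \<open>1 < a\<close> by (intro always_eventually allI) (rule le_less_trans)
    qed
    then show False using not_strong by (simp add: strong_mode_def s_def)
  qed
  then obtain a0 where a0: "a0 < 1" "\<not> eventually (\<lambda>\<epsilon>. a0 < measure \<nu> (ball x \<epsilon>) / s \<epsilon>) (at_right 0)"
    by blast
  define a where "a = max a0 0"
  have a: "0 \<le> a" "a < 1" "a0 \<le> a" using a0 by (auto simp: a_def)
  \<comment> \<open>Two intermediate constants between \<open>a\<close> and \<open>1\<close>: the
    supremum need not be attained, so \<open>y n\<close> reaches only the fraction
    \<open>a / b\<close> of it, and \<open>c / b > 1\<close> leaves room for the limes
    superior.\<close>
  define b where "b = (2 * a + 1) / 3"
  define c where "c = (a + 2) / 3"
  have bc: "a < b" "b < c" "c < 1" "0 < b" using a by (auto simp: b_def c_def)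
  have "\<exists>\<epsilon>. 0 < \<epsilon> \<and> \<epsilon> < inverse (real (Suc n)) \<and> measure \<nu> (ball x \<epsilon>) / s \<epsilon> \<le> a0" for n
  proof (rule ccontr)
    assume "\<not> ?thesis"
    then have "eventually (\<lambda>\<epsilon>. a0 < measure \<nu> (ball x \<epsilon>) / s \<epsilon>) (at_right 0)"
      unfolding eventually_at_right_field
      by (intro exI[of _ "inverse (real (Suc n))"]) (auto simp: not_le)
    with a0 show False by blast
  qed
  then obtain \<epsilon> where \<epsilon>: "\<And>n. 0 < \<epsilon> n" "\<And>n. \<epsilon> n < inverse (real (Suc n))" "\<And>n. measure \<nu> (ball x (\<epsilon> n)) / s (\<epsilon> n) \<le> a0"
    by metis
  have lim: "\<epsilon> \<longlonglongrightarrow> 0"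
    by (rule tendsto_sandwich[OF _ _ tendsto_const LIMSEQ_inverse_real_of_nat])
       (auto intro!: always_eventually less_imp_le \<epsilon>(1) \<epsilon>(2)[simplified])
  have "\<exists>y. (a / b) * s (\<epsilon> n) < measure \<nu> (ball y (\<epsilon> n))" for n
  proof -
    have "(a / b) * s (\<epsilon> n) < 1 * s (\<epsilon> n)"
      using bc s_pos[OF \<epsilon>(1)] by (intro mult_strict_right_mono) auto
    then show ?thesis
      using less_cSUP_iff[OF _ bdd[of "\<epsilon> n"], of "(a / b) * s (\<epsilon> n)"] by (simp add: s_def)
  qed
  then obtain y where y: "\<And>n. (a / b) * s (\<epsilon> n) < measure \<nu> (ball (y n) (\<epsilon> n))"
    by metis
  have xy: "measure \<nu> (ball x (\<epsilon> n)) \<le> b * measure \<nu> (ball (y n) (\<epsilon> n))" for n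
  proof -
    have "measure \<nu> (ball x (\<epsilon> n)) / s (\<epsilon> n) \<le> a" using \<epsilon>(3)[of n] a by linarith
    then have "measure \<nu> (ball x (\<epsilon> n)) \<le> a * s (\<epsilon> n)"
      using s_pos[OF \<epsilon>(1)[of n]] by (simp add: field_simps)
    also have "\<dots> = b * ((a / b) * s (\<epsilon> n))" using bc by simp
    also have "\<dots> \<le> b * measure \<nu> (ball (y n) (\<epsilon> n))"
      using y[of n] bc by (intro mult_left_mono) auto
    finally show ?thesis .
  qed
  have y_pos: "0 < measure \<nu> (ball (y n) (\<epsilon> n))" for n
    using xy[of n] pos[OF \<epsilon>(1)[of n]] bc by (smt (verit) mult_nonneg_nonpos)
  have fl: "filterlim \<epsilon> (at_right 0) sequentially"
    by (rule tendsto_imp_filterlim_at_right[OF lim]) (simp add: \<epsilon>)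
  have Lim: "eventually (\<lambda>\<epsilon>. ereal (measure \<nu> (ball z \<epsilon>) / measure \<nu> (ball x \<epsilon>)) < ereal (c / b)) (at_right 0)" for z
  proof (rule Limsup_lessD)
    have "Limsup (at_right 0) (\<lambda>\<epsilon>. ereal (measure \<nu> (ball z \<epsilon>) / measure \<nu> (ball x \<epsilon>))) \<le> 1"
      using weak by (simp add: weak_mode_def)
    also have "1 < ereal (c / b)" using bc by simp
    finally show "Limsup (at_right 0) (\<lambda>\<epsilon>. ereal (measure \<nu> (ball z \<epsilon>) / measure \<nu> (ball x \<epsilon>))) < ereal (c / b)" .
  qed
  have ev: "eventually (\<lambda>n. ereal (measure \<nu> (ball z (\<epsilon> n)) / measure \<nu> (ball x (\<epsilon> n))) < ereal (c / b)) sequentially" for z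
    by (rule eventually_compose_filterlim[OF Lim fl])
  have "eventually (\<lambda>n. measure \<nu> (ball z (\<epsilon> n)) \<le> c * measure \<nu> (ball (y n) (\<epsilon> n))) sequentially" for z
    using ev[of z]
  proof eventually_elim
    case (elim n)
    then have "measure \<nu> (ball z (\<epsilon> n)) \<le> c / b * measure \<nu> (ball x (\<epsilon> n))"
      using pos[OF \<epsilon>(1)[of n]] by (simp add: divide_less_eq)
    also have "\<dots> \<le> c / b * (b * measure \<nu> (ball (y n) (\<epsilon> n)))"
      using xy[of n] bc by (intro mult_left_mono) auto
    finally show ?case using bc by simp
  qed
  with bc show ?thesis
    by (intro that[of c \<epsilon> y] \<epsilon>(1) lim pos y_pos) auto
qed

section \<open>Relative compactness of centres with non-negligible balls\<close>

context centered_gaussian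
begin

lemma norm_diff_proj_le:
  assumes "finite F" "F \<subseteq> E"
  shows "norm (x - proj F x) \<le> norm x"
proof -
  have "(norm (x - proj F x))\<^sup>2 \<le> (norm x)\<^sup>2"
    using norm_diff_proj[OF assms, of x] by (simp add: sum_nonneg)
  then show ?thesis by (rule power2_le_imp_le) simp
qed

lemma proj_diff: "proj F (x - y) = proj F x - proj F y"
  by (simp add: proj_def inner_diff_left scaleR_diff_left sum_subtractf)

text \<open>A centre whose small ball is not negligible against the centred one has a bounded \<open>Q F a\<close>
  for every large \<open>a\<close>, so it is close to the span of the finitely many eigenvectors in \<open>F\<close>.\<close>

lemma convergent_subseq_of_ball_measure_ge:
  assumes \<epsilon>: "\<And>n. 0 < \<epsilon> n" "\<epsilon> \<longlonglongrightarrow> 0" and c: "c > 0"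
    and pos: "\<And>n. 0 < measure M (ball 0 (\<epsilon> n))"
    and x: "\<And>n. norm (x n) \<le> R"
    and ge: "\<And>n. c * measure M (ball 0 (\<epsilon> n)) \<le> measure M (ball (x n) (\<epsilon> n))"
  obtains r z where "strict_mono (r :: nat \<Rightarrow> nat)" "(\<lambda>n. x (r n)) \<longlonglongrightarrow> z"
proof -
  have tail: "\<exists>F. finite F \<and> F \<subseteq> E \<and> eventually (\<lambda>n. norm (x n - proj F (x n)) < 2 * \<delta>) sequentially"
    if \<delta>: "\<delta> > 0" for \<delta>
  proof -
    \<comment> \<open>\<open>C\<close> exceeds \<open>2 * ln (2 / c)\<close>, so a loss of
      \<open>exp (C / 2)\<close> contradicts the assumed lower bound; \<open>a\<close> is scaled so
      that a residual of norm \<open>\<delta>\<close> already contributes \<open>C\<close> to the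
      form.\<close>
    define C where "C = \<bar>2 * ln (2 / c)\<bar> + 1"
    define a where "a = C / \<delta>\<^sup>2"
    have C: "C > 0" by (simp add: C_def)
    then have a: "a > 0" using \<delta> by (simp add: a_def)
    define F where "F = {e \<in> E. lam e \<ge> 1 / a}"
    have F: "finite F" "F \<subseteq> E"
      unfolding F_def using a by (auto intro: finite_lam_ge)
    have off: "a * lam e \<le> 1" if "e \<in> E - F" for e
      using that a by (auto simp: F_def field_simps not_le)
    have "(\<lambda>n. exp (Q_bound F a * (\<epsilon> n)\<^sup>2 / 2)) \<longlonglongrightarrow> exp (Q_bound F a * 0\<^sup>2 / 2)"
      by (intro tendsto_intros \<epsilon>) auto
    then have "eventually (\<lambda>n. exp (Q_bound F a * (\<epsilon> n)\<^sup>2 / 2) < 2) sequentially"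
      by (rule order_tendstoD) simp
    moreover have "eventually (\<lambda>n. \<epsilon> n < \<delta>) sequentially"
      using order_tendstoD(2)[OF \<epsilon>(2) \<delta>] .
    ultimately have "eventually (\<lambda>n. norm (x n - proj F (x n)) < 2 * \<delta>) sequentially"
    proof eventually_elim
      case (elim n)
      define d where "d = norm (x n - proj F (x n))"
      show ?case
      proof (rule ccontr)
        assume "\<not> ?case"
        then have d: "d \<ge> 2 * \<delta>" by (simp add: d_def)
        \<comment> \<open>The map \<open>u - proj F u\<close> is linear and does not increase norms,
          so of the residual \<open>2 * \<delta>\<close> at the centre at least
          \<open>\<delta>\<close> survives throughout the ball.\<close>
        have "C \<le> Q F a u" if u: "u \<in> ball (x n) (\<epsilon> n)" for u
        proof -
          have "d = norm ((u - proj F u) + ((x n - u) - proj F (x n - u)))"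
            by (simp add: d_def proj_diff)
          also have "\<dots> \<le> norm (u - proj F u) + norm ((x n - u) - proj F (x n - u))"
            by (rule norm_triangle_ineq)
          also have "norm ((x n - u) - proj F (x n - u)) \<le> norm (x n - u)"
            by (rule norm_diff_proj_le[OF F])
          also have "norm (x n - u) < \<delta>" using u elim by (simp add: dist_norm)
          finally have "\<delta> \<le> norm (u - proj F u)" using d by simp
          then have "a * \<delta>\<^sup>2 \<le> a * (norm (u - proj F u))\<^sup>2"
            using a \<delta> by (intro mult_left_mono power_mono) auto
          then have "C \<le> a * (norm (u - proj F u))\<^sup>2" using \<delta> by (simp add: a_def)
          then show ?thesis
            using Q_eq_diff_proj[OF F less_imp_le[OF a], of u] sum_inner_div_lam_nonneg[OF F(2), of u] by linarith
        qed
        then have "exp (C / 2) * measure M (ball (x n) (\<epsilon> n)) \<le> exp (Q_bound F a * (\<epsilon> n)\<^sup>2 / 2) * measure M (ball 0 (\<epsilon> n))"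
          using a by (intro ball_measure_le F off \<epsilon>) auto
        also have "\<dots> \<le> 2 * measure M (ball 0 (\<epsilon> n))"
          using elim by (intro mult_right_mono) auto
        finally have "exp (C / 2) * (c * measure M (ball 0 (\<epsilon> n))) \<le> 2 * measure M (ball 0 (\<epsilon> n))"
          using mult_left_mono[OF ge[of n] exp_ge_zero, of "C / 2"] by linarith
        then have "exp (C / 2) * c \<le> 2"
          using pos[of n] by (simp add: mult.assoc[symmetric])
        then have "exp (C / 2) \<le> 2 / c" using c by (simp add: field_simps)
        also have "2 / c = exp (ln (2 / c))" using c by simp
        finally have "C / 2 \<le> ln (2 / c)" by simp
        then show False by (simp add: C_def)
      qed
    qed
    with F show ?thesis by blast
  qed
  \<comment> \<open>Weak convergence settles the finitely many coordinates in \<open>F\<close>, and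
    the residuals are eventually small; together they upgrade it to norm convergence.\<close>
  obtain r :: "nat \<Rightarrow> nat" where r: "strict_mono r" "\<And>y. Cauchy (\<lambda>n. x (r n) \<bullet> y)"
    using bounded_seq_weakly_Cauchy_subseq[of x R, OF x] by blast
  have "Cauchy (\<lambda>n. x (r n))"
  proof (rule CauchyI)
    fix \<eta> :: real assume "\<eta> > 0"
    then obtain F where F: "finite F" "F \<subseteq> E"
      and ev: "eventually (\<lambda>n. norm (x n - proj F (x n)) < 2 * (\<eta> / 6)) sequentially"
      using tail[of "\<eta> / 6"] by auto
    have "eventually (\<lambda>n. norm (x (r n) - proj F (x (r n))) < \<eta> / 3) sequentially"
      using eventually_subseq[OF r(1) ev] by simp
    then obtain K1 where K1: "\<And>n. n \<ge> K1 \<Longrightarrow> norm (x (r n) - proj F (x (r n))) < \<eta> / 3"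
      by (auto simp: eventually_sequentially)
    have "convergent (\<lambda>n. x (r n) \<bullet> f)" for f
      using r(2) by (simp add: Cauchy_convergent_iff)
    then obtain l where "\<And>f. (\<lambda>n. x (r n) \<bullet> f) \<longlonglongrightarrow> l f"
      unfolding convergent_def by metis
    then have "(\<lambda>n. proj F (x (r n))) \<longlonglongrightarrow> (\<Sum>f\<in>F. l f *\<^sub>R f)"
      unfolding proj_def by (intro tendsto_intros)
    then have "Cauchy (\<lambda>n. proj F (x (r n)))" by (rule LIMSEQ_imp_Cauchy)
    then obtain K2 where K2: "\<And>m n. m \<ge> K2 \<Longrightarrow> n \<ge> K2 \<Longrightarrow> norm (proj F (x (r m)) - proj F (x (r n))) < \<eta> / 3"
      using CauchyD[of "\<lambda>n. proj F (x (r n))" "\<eta> / 3"] \<open>\<eta> > 0\<close> by auto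
    show "\<exists>K. \<forall>m\<ge>K. \<forall>n\<ge>K. norm (x (r m) - x (r n)) < \<eta>"
    proof (intro exI[of _ "max K1 K2"] allI impI)
      fix m n assume mn: "max K1 K2 \<le> m" "max K1 K2 \<le> n"
      let ?p = "\<lambda>n. proj F (x (r n))"
      have "norm (x (r m) - x (r n)) = norm ((x (r m) - ?p m) - (x (r n) - ?p n) + (?p m - ?p n))"
        by simp
      also have "\<dots> \<le> norm (x (r m) - ?p m) + norm (x (r n) - ?p n) + norm (?p m - ?p n)"
        by (meson add_right_mono norm_triangle_ineq norm_triangle_ineq4 order_trans)
      also have "\<dots> < \<eta>" using K1[of m] K1[of n] K2[of m n] mn by simp
      finally show "norm (x (r m) - x (r n)) < \<eta>" .
    qed
  qed
  then obtain z where "(\<lambda>n. x (r n)) \<longlonglongrightarrow> z"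
    by (auto simp: Cauchy_convergent_iff convergent_def)
  with r(1) show ?thesis by (rule that)
qed

section \<open>Modes of the reweighted measure \<open>\<nu>\<close>\<close>

context
  fixes \<Phi> :: "'a \<Rightarrow> real" and Z :: real and \<nu> :: "'a measure"
  assumes \<Phi>[measurable]: "\<Phi> \<in> borel_measurable borel" and Z: "Z > 0"
    and \<nu>: "\<nu> = density M (\<lambda>u. ennreal (exp (- \<Phi> u) / Z))" and prob_\<nu>: "prob_space \<nu>"
begin

lemma posterior_measure_le:
  assumes A: "A \<in> sets borel" and k: "\<And>u. u \<in> A \<Longrightarrow> k \<le> \<Phi> u"
  shows "measure \<nu> A \<le> exp (- k) / Z * measure M A"
proof -
  interpret \<nu>: prob_space \<nu> by (rule prob_\<nu>)
  have [measurable]: "A \<in> sets M" using A by (simp add: sets_M)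
  have "emeasure \<nu> A = (\<integral>\<^sup>+u. ennreal (exp (- \<Phi> u) / Z) * indicator A u \<partial>M)"
    unfolding \<nu> by (rule emeasure_density) measurable
  also have "\<dots> \<le> (\<integral>\<^sup>+u. ennreal (exp (- k) / Z) * indicator A u \<partial>M)"
    using k Z by (intro nn_integral_mono) (auto simp: indicator_def intro!: ennreal_leI divide_right_mono)
  also have "\<dots> = ennreal (exp (- k) / Z) * emeasure M A"
    by (rule nn_integral_cmult_indicator) simp
  finally show ?thesis
    using Z by (simp add: \<nu>.emeasure_eq_measure emeasure_eq_measure flip: ennreal_mult)
qed

lemma posterior_measure_ge:
  assumes A: "A \<in> sets borel" and k: "\<And>u. u \<in> A \<Longrightarrow> \<Phi> u \<le> k"
  shows "exp (- k) / Z * measure M A \<le> measure \<nu> A"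
proof -
  interpret \<nu>: prob_space \<nu> by (rule prob_\<nu>)
  have [measurable]: "A \<in> sets M" using A by (simp add: sets_M)
  have "ennreal (exp (- k) / Z) * emeasure M A = (\<integral>\<^sup>+u. ennreal (exp (- k) / Z) * indicator A u \<partial>M)"
    by (rule nn_integral_cmult_indicator[symmetric]) simp
  also have "\<dots> \<le> (\<integral>\<^sup>+u. ennreal (exp (- \<Phi> u) / Z) * indicator A u \<partial>M)"
    using k Z by (intro nn_integral_mono) (auto simp: indicator_def intro!: ennreal_leI divide_right_mono)
  also have "\<dots> = emeasure \<nu> A"
    unfolding \<nu> by (rule emeasure_density[symmetric]) measurable
  finally show ?thesis
    using Z by (simp add: \<nu>.emeasure_eq_measure emeasure_eq_measure flip: ennreal_mult)
qed

text \<open>\<open>\<Phi>\<close> can favour a distant centre only by a factor exponential in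
  \<open>norm y\<close>, while the Gaussian loss is quadratic in the exponent: all eigenvalues are
  at most \<open>B\<close>, so \<open>(norm u)\<^sup>2 / B\<close> is an admissible form with
  \<open>F = {}\<close>.\<close>

lemma near_mode_centers_bounded:
  assumes lip: "\<And>u. u \<in> ball 0 1 \<Longrightarrow> \<bar>\<Phi> u - \<Phi> 0\<bar> \<le> L"
    and lower: "K \<ge> 0" "\<And>u. \<Phi> u \<ge> \<Phi> 0 - K * norm u"
    and \<epsilon>: "0 < \<epsilon>" "\<epsilon> < 1" and pos: "0 < measure M (ball 0 \<epsilon>)"
    and ge: "measure \<nu> (ball 0 \<epsilon>) \<le> measure \<nu> (ball y \<epsilon>)"
  shows "norm y \<le> 6 * B * (K + L + 1) + 2"
    and "exp (- L - K * (norm y + 1)) * measure M (ball 0 \<epsilon>) \<le> measure M (ball y \<epsilon>)"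
proof -
  have "0 \<le> L" using lip[of 0] by simp
  have "exp (- (\<Phi> 0 + L)) / Z * measure M (ball 0 \<epsilon>) \<le> measure \<nu> (ball 0 \<epsilon>)"
  proof (rule posterior_measure_ge)
    fix u :: 'a assume "u \<in> ball 0 \<epsilon>"
    then show "\<Phi> u \<le> \<Phi> 0 + L" using lip[of u] \<epsilon> by auto
  qed simp
  also note ge
  also have "measure \<nu> (ball y \<epsilon>) \<le> exp (- (\<Phi> 0 - K * (norm y + 1))) / Z * measure M (ball y \<epsilon>)"
  proof (rule posterior_measure_le)
    fix u assume "u \<in> ball y \<epsilon>"
    then have "norm u \<le> norm y + 1"
      using \<epsilon> norm_triangle_ineq2[of u y] by (auto simp: dist_norm norm_minus_commute)
    then have "K * norm u \<le> K * (norm y + 1)" using lower(1) by (rule mult_left_mono)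
    then show "\<Phi> 0 - K * (norm y + 1) \<le> \<Phi> u" using lower(2)[of u] by linarith
  qed simp
  finally have "exp (- (\<Phi> 0 + L)) * measure M (ball 0 \<epsilon>) \<le> exp (- (\<Phi> 0 - K * (norm y + 1))) * measure M (ball y \<epsilon>)"
    using Z by (simp add: field_simps)
  then have "exp (\<Phi> 0 - K * (norm y + 1)) * (exp (- (\<Phi> 0 + L)) * measure M (ball 0 \<epsilon>))
     \<le> exp (\<Phi> 0 - K * (norm y + 1)) * (exp (- (\<Phi> 0 - K * (norm y + 1))) * measure M (ball y \<epsilon>))"
    by (rule mult_left_mono) simp
  moreover have "exp (\<Phi> 0 - K * (norm y + 1)) * exp (- (\<Phi> 0 + L)) = exp (- L - K * (norm y + 1))"
    by (subst exp_add[symmetric]) (simp add: algebra_simps)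
  moreover have "exp (\<Phi> 0 - K * (norm y + 1)) * exp (- (\<Phi> 0 - K * (norm y + 1))) = 1"
    by (subst exp_add[symmetric]) simp
  ultimately show *: "exp (- L - K * (norm y + 1)) * measure M (ball 0 \<epsilon>) \<le> measure M (ball y \<epsilon>)"
    by (simp only: mult.assoc[symmetric] mult_1)
  show "norm y \<le> 6 * B * (K + L + 1) + 2"
  proof (rule ccontr)
    \<comment> \<open>\<open>t\<close> bounds \<open>norm u\<close> from below on
      \<open>ball y \<epsilon>\<close>, since \<open>\<epsilon> < 1\<close>. The claimed radius
      comes from the bound on \<open>t\<close> obtained at the end, with the constant absorbed by
      \<open>B \<ge> 1\<close>.\<close>
    define t where "t = norm y - 1"
    assume "\<not> ?thesis"
    then have t: "t > 6 * B * (K + L + 1) + 1" by (simp add: t_def)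
    have "6 * B * (K + L + 1) \<ge> 0"
      using B_pos lower(1) \<open>0 \<le> L\<close> by simp
    with t have t1: "t > 1" by linarith
    have "exp (t\<^sup>2 / B / 2) * measure M (ball y \<epsilon>) \<le> exp (Q_bound {} (1 / B) * \<epsilon>\<^sup>2 / 2) * measure M (ball 0 \<epsilon>)"
    proof (rule ball_measure_le)
      show "1 / B * lam e \<le> 1" if "e \<in> E - {}" for e
        using that lam_le_B[of e] B_pos by simp
      fix u assume "u \<in> ball y \<epsilon>"
      then have "t \<le> norm u"
        using \<epsilon> norm_triangle_ineq2[of y u] by (auto simp: dist_norm t_def)
      then have "t\<^sup>2 \<le> (norm u)\<^sup>2" using t1 by (intro power_mono) auto
      then show "t\<^sup>2 / B \<le> Q {} (1 / B) u"
        using B_pos by (simp add: Q_def divide_right_mono)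
    qed (use B_pos \<epsilon> in auto)
    also have "\<dots> \<le> exp (1 / B) * measure M (ball 0 \<epsilon>)"
    proof -
      have "\<epsilon>\<^sup>2 \<le> 2" using power_mono[of \<epsilon> 1 2] \<epsilon> by simp
      then have "1 / B * \<epsilon>\<^sup>2 \<le> 1 / B * 2" using B_pos by (intro mult_left_mono) auto
      then show ?thesis by (intro mult_right_mono) (auto simp: Q_bound_def)
    qed
    finally have "exp (t\<^sup>2 / B / 2) * (exp (- L - K * (t + 2)) * measure M (ball 0 \<epsilon>)) \<le> exp (1 / B) * measure M (ball 0 \<epsilon>)"
    proof (rule order_trans[rotated])
      have "t + 2 = norm y + 1" by (simp add: t_def)
      then show "exp (t\<^sup>2 / B / 2) * (exp (- L - K * (t + 2)) * measure M (ball 0 \<epsilon>)) \<le> exp (t\<^sup>2 / B / 2) * measure M (ball y \<epsilon>)"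
        using * by (intro mult_left_mono) (simp_all only: exp_ge_zero)
    qed
    then have "exp (t\<^sup>2 / B / 2 + (- L - K * (t + 2))) \<le> exp (1 / B)"
      using pos by (simp add: mult.assoc[symmetric] exp_add)
    then have "t\<^sup>2 / B / 2 \<le> 1 / B + L + K * (t + 2)" by simp
    then have "2 * B * (t\<^sup>2 / B / 2) \<le> 2 * B * (1 / B + L + K * (t + 2))"
      using B_pos by (intro mult_left_mono) auto
    then have "t\<^sup>2 \<le> 2 * B * (1 / B + L + K * (t + 2))"
      using B_pos by simp
    also have "\<dots> = 2 + 2 * B * (L + K * (t + 2))"
      using B_pos by (simp add: field_simps)
    \<comment> \<open>Since \<open>t > 1\<close>, also \<open>t + 2 \<le> 3 * t\<close>; the
      right-hand side becomes a multiple of \<open>t\<close>, and one factor \<open>t\<close>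
      cancels.\<close>
    also have "\<dots> \<le> 2 * t + 2 * B * (L * t + K * (3 * t))"
      using t1 B_pos lower(1) \<open>0 \<le> L\<close> mult_left_mono[of 1 t L]
      by (intro add_mono mult_left_mono) auto
    also have "\<dots> = (2 + 2 * B * L + 6 * B * K) * t" by (simp add: algebra_simps)
    finally have "t \<le> 2 + 2 * B * L + 6 * B * K" using t1 by (simp add: power2_eq_square)
    moreover have "2 * B * L \<le> 6 * B * L" using B_pos \<open>0 \<le> L\<close> by (intro mult_right_mono) auto
    moreover have "B \<ge> 1" using onorm_pos_le[OF bl] by (simp add: B_def)
    ultimately show False using t by (simp add: algebra_simps)
  qed
qed

text \<open>At \<open>z\<close> the form \<open>Q F 0\<close> equals the squared Cameron--Martin
  norm \<open>q\<close> of \<open>p\<close>, so \<open>q\<close> cancels between the lower bound at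
  \<open>p\<close> and the upper bound at \<open>y n\<close>. Of the gap \<open>s\<close> in
  \<open>c = exp (- s)\<close>, one quarter pays for \<open>\<Phi> p\<close> against
  \<open>\<Phi> z\<close>, one for the oscillation of the form near \<open>z\<close>, and less than
  one for \<open>g n\<close>; this leaves a contradiction.\<close>

lemma posterior_ratio_liminf:
  assumes lip: "L > 0" "\<And>u v. u \<in> ball 0 R \<Longrightarrow> v \<in> ball 0 R \<Longrightarrow> \<bar>\<Phi> u - \<Phi> v\<bar> \<le> L * norm (u - v)"
    and R: "R = norm z + 2"
    and \<epsilon>: "\<And>n. 0 < \<epsilon> n" "\<epsilon> \<longlonglongrightarrow> 0" and pos: "\<And>n. 0 < measure M (ball 0 (\<epsilon> n))"
    and y: "y \<longlonglongrightarrow> z" and c: "0 < c"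
    and le: "\<And>w. eventually (\<lambda>n. measure \<nu> (ball w (\<epsilon> n)) \<le> c * measure \<nu> (ball (y n) (\<epsilon> n))) sequentially"
  shows "1 \<le> c"
proof (rule ccontr)
  assume "\<not> 1 \<le> c"
  define s where "s = ln (1 / c)"
  have s: "s > 0" "c = exp (- s)"
    using c \<open>\<not> 1 \<le> c\<close> by (auto simp: s_def ln_div)
  define \<delta> where "\<delta> = min 1 (s / (4 * L))"
  have \<delta>: "\<delta> > 0" "\<delta> \<le> 1" "L * \<delta> \<le> s / 4"
    using s lip(1) by (auto simp: \<delta>_def min_def field_simps)
  obtain F where F: "finite F" "F \<subseteq> E" "norm (z - proj F z) < \<delta>"
    using proj_approx[OF \<delta>(1)] by blast
  define p where "p = proj F z"
  define q where "q = Q F 0 z"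
  have q: "q = (\<Sum>f\<in>F. (z \<bullet> f)\<^sup>2 / lam f)" by (simp add: q_def Q_eq)
  have "isCont (Q F 0) z"
    using continuous_Q[of F 0] by (simp add: continuous_on_eq_continuous_at)
  then obtain \<rho> where \<rho>: "\<rho> > 0" "\<And>u. dist u z < \<rho> \<Longrightarrow> dist (Q F 0 u) (Q F 0 z) < s / 2"
    using s unfolding continuous_at_eps_delta by (meson half_gt_zero)
  \<comment> \<open>The radius \<open>norm z + 2\<close> has room for \<open>p\<close> and
    eventually \<open>y n\<close>, both within \<open>1\<close> of \<open>z\<close>, together with
    their balls of radius below \<open>1 / 2\<close>.\<close>
  have pR: "norm p < norm z + 1"
    using F(3) \<delta>(2) norm_triangle_ineq2[of p z] by (simp add: p_def norm_minus_commute)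
  have \<Phi>p: "\<Phi> p \<le> \<Phi> z + s / 4"
  proof -
    have "\<bar>\<Phi> p - \<Phi> z\<bar> \<le> L * norm (p - z)"
      using pR by (intro lip) (auto simp: R)
    also have "\<dots> \<le> L * \<delta>" using F(3) lip(1) by (simp add: p_def norm_minus_commute)
    finally show ?thesis using \<delta>(3) by linarith
  qed
  define g where "g n = L * \<epsilon> n + L * (dist (y n) z + \<epsilon> n) + Q_bound F 0 * (\<epsilon> n)\<^sup>2 / 2" for n
  have "g \<longlonglongrightarrow> L * 0 + L * (0 + 0) + Q_bound F 0 * 0\<^sup>2 / 2"
    unfolding g_def using tendsto_dist[OF y tendsto_const, of z] by (intro tendsto_intros \<epsilon>(2)) auto
  then have "eventually (\<lambda>n. g n < s / 4) sequentially"
    using s by (intro order_tendstoD) auto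
  moreover have "eventually (\<lambda>n. \<epsilon> n < min (\<rho> / 2) (1 / 2)) sequentially"
    using \<rho>(1) by (intro order_tendstoD(2)[OF \<epsilon>(2)]) auto
  moreover have "eventually (\<lambda>n. dist (y n) z < min (\<rho> / 2) 1) sequentially"
    using \<rho>(1) tendstoD[OF y, of "min (\<rho> / 2) 1"] by auto
  ultimately have "eventually (\<lambda>n. False) sequentially"
    using le[of p]
  proof eventually_elim
    case (elim n)
    have "exp (- (\<Phi> p + L * \<epsilon> n)) / Z * (exp (- q / 2) * measure M (ball 0 (\<epsilon> n))) \<le> exp (- (\<Phi> p + L * \<epsilon> n)) / Z * measure M (ball p (\<epsilon> n))"
      unfolding q p_def using Z by (intro mult_left_mono ball_measure_ge F \<epsilon>) auto
    also have "\<dots> \<le> measure \<nu> (ball p (\<epsilon> n))"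
    proof (rule posterior_measure_ge)
      fix u assume u: "u \<in> ball p (\<epsilon> n)"
      then have nu: "norm (u - p) < \<epsilon> n" by (simp add: dist_norm norm_minus_commute)
      then have "norm u < R"
        using elim pR norm_triangle_ineq2[of u p] by (simp add: R)
      then have "\<bar>\<Phi> u - \<Phi> p\<bar> \<le> L * norm (u - p)"
        using pR by (intro lip) (auto simp: R)
      also have "\<dots> \<le> L * \<epsilon> n" using nu lip(1) by simp
      finally show "\<Phi> u \<le> \<Phi> p + L * \<epsilon> n" by linarith
    qed simp
    also have "\<dots> \<le> c * measure \<nu> (ball (y n) (\<epsilon> n))" by (rule elim)
    also have "\<dots> \<le> c * (exp (- (\<Phi> z - L * (dist (y n) z + \<epsilon> n))) / Z * measure M (ball (y n) (\<epsilon> n)))"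
    proof (intro mult_left_mono posterior_measure_le)
      fix u assume u: "u \<in> ball (y n) (\<epsilon> n)"
      then have nu: "norm (u - z) < dist (y n) z + \<epsilon> n"
        using dist_triangle[of u z "y n"] by (simp add: dist_norm norm_minus_commute)
      then have "norm u < R"
        using elim norm_triangle_ineq2[of u z] by (simp add: R)
      then have "\<bar>\<Phi> u - \<Phi> z\<bar> \<le> L * norm (u - z)"
        by (intro lip) (auto simp: R)
      also have "\<dots> \<le> L * (dist (y n) z + \<epsilon> n)" using nu lip(1) by simp
      finally show "\<Phi> z - L * (dist (y n) z + \<epsilon> n) \<le> \<Phi> u" by linarith
    qed (use c in auto)
    also have "measure M (ball (y n) (\<epsilon> n)) \<le> exp (- (q - s / 2) / 2) * (exp (Q_bound F 0 * (\<epsilon> n)\<^sup>2 / 2) * measure M (ball 0 (\<epsilon> n)))"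
    proof -
      have "exp ((q - s / 2) / 2) * measure M (ball (y n) (\<epsilon> n)) \<le> exp (Q_bound F 0 * (\<epsilon> n)\<^sup>2 / 2) * measure M (ball 0 (\<epsilon> n))"
      proof (rule ball_measure_le)
        fix u assume "u \<in> ball (y n) (\<epsilon> n)"
        then have "dist u z < \<rho>"
          using elim dist_triangle[of u z "y n"] by (simp add: dist_commute)
        from \<rho>(2)[OF this] show "q - s / 2 \<le> Q F 0 u" unfolding q_def dist_real_def by linarith
      qed (use F \<epsilon> in auto)
      then have "exp (- (q - s / 2) / 2) * (exp ((q - s / 2) / 2) * measure M (ball (y n) (\<epsilon> n)))
          \<le> exp (- (q - s / 2) / 2) * (exp (Q_bound F 0 * (\<epsilon> n)\<^sup>2 / 2) * measure M (ball 0 (\<epsilon> n)))"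
        by (rule mult_left_mono) simp
      moreover have "exp (- (q - s / 2) / 2) * exp ((q - s / 2) / 2) = 1"
        by (subst exp_add[symmetric]) (simp add: field_simps)
      ultimately show ?thesis
        by (simp only: mult.assoc[symmetric] mult_1)
    qed
    finally have "exp (- (\<Phi> p + L * \<epsilon> n)) / Z * (exp (- q / 2) * measure M (ball 0 (\<epsilon> n)))
      \<le> c * (exp (- (\<Phi> z - L * (dist (y n) z + \<epsilon> n))) / Z * (exp (- (q - s / 2) / 2) * (exp (Q_bound F 0 * (\<epsilon> n)\<^sup>2 / 2) * measure M (ball 0 (\<epsilon> n)))))"
      using c Z by (simp add: mult_left_mono divide_right_mono)
    then have "exp (- (\<Phi> p + L * \<epsilon> n)) * exp (- q / 2)
      \<le> exp (- s) * exp (- (\<Phi> z - L * (dist (y n) z + \<epsilon> n))) * exp (- (q - s / 2) / 2) * exp (Q_bound F 0 * (\<epsilon> n)\<^sup>2 / 2)"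
      using pos[of n] Z unfolding s(2) by (simp add: field_simps)
    then have "- (\<Phi> p + L * \<epsilon> n) + - q / 2 \<le> - s + - (\<Phi> z - L * (dist (y n) z + \<epsilon> n)) + - (q - s / 2) / 2 + Q_bound F 0 * (\<epsilon> n)\<^sup>2 / 2"
      by (simp only: exp_add[symmetric] exp_le_cancel_iff)
    then have "s \<le> s / 4 + s / 4 + g n"
      using \<Phi>p unfolding g_def by (simp add: diff_divide_distrib)
    then show False using elim s by linarith
  qed
  then show False by simp
qed

lemma weak_mode_imp_strong_mode:
  assumes lip: "\<forall>r>0. \<exists>L>0. \<forall>x1\<in>ball 0 r. \<forall>x2\<in>ball 0 r. \<bar>\<Phi> x1 - \<Phi> x2\<bar> \<le> L * norm (x1 - x2)"
    and lower: "K \<ge> 0" "\<And>u. \<Phi> u \<ge> \<Phi> 0 - K * norm u"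
    and weak: "weak_mode \<nu> x"
  shows "strong_mode \<nu> x"
proof (rule ccontr)
  assume not_strong: "\<not> strong_mode \<nu> x"
  obtain c \<epsilon> y where c: "0 < c" "c < 1" and \<epsilon>: "\<And>n. 0 < \<epsilon> n" "\<epsilon> \<longlonglongrightarrow> 0"
    and pos: "\<And>n. 0 < measure \<nu> (ball x (\<epsilon> n))"
    and le: "\<And>z. eventually (\<lambda>n. measure \<nu> (ball z (\<epsilon> n)) \<le> c * measure \<nu> (ball (y n) (\<epsilon> n))) sequentially"
    and y_pos: "\<And>n. 0 < measure \<nu> (ball (y n) (\<epsilon> n))"
    by (rule weak_not_strong_modeE[OF prob_\<nu> weak not_strong]) (rule that)
  obtain L where L: "L > 0" "\<And>u v. u \<in> ball 0 1 \<Longrightarrow> v \<in> ball 0 1 \<Longrightarrow> \<bar>\<Phi> u - \<Phi> v\<bar> \<le> L * norm (u - v)"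
    using lip zero_less_one by blast
  have L1: "\<bar>\<Phi> u - \<Phi> 0\<bar> \<le> L" if "u \<in> ball 0 1" for u
  proof -
    have "\<bar>\<Phi> u - \<Phi> 0\<bar> \<le> L * norm (u - 0)" using that by (intro L) auto
    also have "\<dots> \<le> L * 1" using that L(1) by (intro mult_left_mono) auto
    finally show ?thesis by simp
  qed
  have M_pos: "0 < measure M (ball 0 (\<epsilon> n))" for n
  proof -
    have "measure M (ball x (\<epsilon> n)) \<noteq> 0"
    proof
      assume "measure M (ball x (\<epsilon> n)) = 0"
      then have "ball x (\<epsilon> n) \<in> null_sets M" by (auto simp: null_sets_def emeasure_eq_measure sets_M)
      moreover have "absolutely_continuous M \<nu>"
        unfolding \<nu> by (intro absolutely_continuousI_density) measurable
      ultimately have "ball x (\<epsilon> n) \<in> null_sets \<nu>" by (auto simp: absolutely_continuous_def)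
      then show False using pos[of n] by (simp add: measure_def null_sets_def)
    qed
    then have p: "0 < measure M (ball x (\<epsilon> n))" by (simp add: less_le)
    \<comment> \<open>With the zero form the estimate says that the centred ball is the largest, so
      it inherits positivity from the ball at \<open>x\<close>.\<close>
    have "exp (0 / 2) * measure M (ball x (\<epsilon> n)) \<le> exp (Q_bound {} 0 * (\<epsilon> n)\<^sup>2 / 2) * measure M (ball 0 (\<epsilon> n))"
      by (rule ball_measure_le) (auto simp: \<epsilon> Q_def)
    with p show ?thesis by (simp add: Q_bound_def)
  qed
  define R where "R = 6 * B * (K + L + 1) + 2"
  define c' where "c' = exp (- L - K * (R + 1))"
  have "eventually (\<lambda>n. norm (y n) \<le> R \<and> c' * measure M (ball 0 (\<epsilon> n)) \<le> measure M (ball (y n) (\<epsilon> n))) sequentially"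
    using le[of 0] order_tendstoD(2)[OF \<epsilon>(2) zero_less_one]
  proof eventually_elim
    case (elim n)
    have "c * measure \<nu> (ball (y n) (\<epsilon> n)) \<le> 1 * measure \<nu> (ball (y n) (\<epsilon> n))"
      using c by (intro mult_right_mono) auto
    then have "measure \<nu> (ball 0 (\<epsilon> n)) \<le> measure \<nu> (ball (y n) (\<epsilon> n))"
      using elim by linarith
    note nm = near_mode_centers_bounded[OF L1 lower \<epsilon>(1) elim(2) M_pos this]
    have nR: "norm (y n) \<le> R" unfolding R_def using nm(1) by simp
    have "c' \<le> exp (- L - K * (norm (y n) + 1))"
      using nR lower(1) by (simp add: c'_def mult_left_mono)
    then have "c' * measure M (ball 0 (\<epsilon> n)) \<le> exp (- L - K * (norm (y n) + 1)) * measure M (ball 0 (\<epsilon> n))"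
      by (rule mult_right_mono) simp
    then show ?case using nm(2) nR by auto
  qed
  \<comment> \<open>The bounds hold only eventually but are needed at every index, hence the shift
    by \<open>N\<close>.\<close>
  then obtain N where N: "\<And>n. norm (y (n + N)) \<le> R"
    "\<And>n. c' * measure M (ball 0 (\<epsilon> (n + N))) \<le> measure M (ball (y (n + N)) (\<epsilon> (n + N)))"
    unfolding eventually_sequentially by (meson le_add2)
  have "(\<lambda>n. \<epsilon> (n + N)) \<longlonglongrightarrow> 0" by (rule LIMSEQ_ignore_initial_segment[OF \<epsilon>(2)])
  then obtain r z where r: "strict_mono (r :: nat \<Rightarrow> nat)" and z: "(\<lambda>n. y (r n + N)) \<longlonglongrightarrow> z"
    using convergent_subseq_of_ball_measure_ge[of "\<lambda>n. \<epsilon> (n + N)" c' "\<lambda>n. y (n + N)" R] \<epsilon>(1) M_pos N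
    by (auto simp: c'_def)
  define r' where "r' n = r n + N" for n
  have r': "strict_mono r'" using r by (auto simp: r'_def strict_mono_def)
  \<comment> \<open>The radius for the Lipschitz bound depends on the limit \<open>z\<close> and can
    be chosen only now.\<close>
  obtain L' where L': "L' > 0" "\<And>u v. u \<in> ball 0 (norm z + 2) \<Longrightarrow> v \<in> ball 0 (norm z + 2) \<Longrightarrow> \<bar>\<Phi> u - \<Phi> v\<bar> \<le> L' * norm (u - v)"
    using lip[rule_format, of "norm z + 2"] by (auto simp: add_nonneg_pos)
  have "1 \<le> c"
  proof (rule posterior_ratio_liminf[OF L' refl, where \<epsilon> = "\<lambda>n. \<epsilon> (r' n)" and y = "\<lambda>n. y (r' n)"])
    show "(\<lambda>n. \<epsilon> (r' n)) \<longlonglongrightarrow> 0"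
      using LIMSEQ_subseq_LIMSEQ[OF \<epsilon>(2) r'] by (simp add: o_def)
    show "(\<lambda>n. y (r' n)) \<longlonglongrightarrow> z" using z by (simp add: r'_def)
    show "eventually (\<lambda>n. measure \<nu> (ball w (\<epsilon> (r' n))) \<le> c * measure \<nu> (ball (y (r' n)) (\<epsilon> (r' n)))) sequentially" for w
      by (rule eventually_subseq[OF r' le])
  qed (use \<epsilon> M_pos c in auto)
  with c show False by simp
qed

end

end

section \<open>From the stated hypotheses to the characteristic function, and the conclusion\<close>

lemma centered_gaussianI:
  fixes M :: "'a::{real_inner, banach, polish_space} measure"
  assumes "gaussian_measure M" and mean: "has_mean M 0" and cov: "covariance_operator M S" and "inj S"
  shows "centered_gaussian M S"
proof -
  have "prob_space M" and sets: "sets M = sets borel"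
    using assms(1) by (auto simp: gaussian_measure_def borel_prob_def)
  interpret prob_space M by fact
  obtain m where m: "has_mean M m" and bl: "bounded_linear S"
    and S: "\<And>h k. S h \<bullet> k = (\<integral>x. (h \<bullet> (x - m)) * (k \<bullet> (x - m)) \<partial>M)"
    using cov unfolding covariance_operator_def by blast
  \<comment> \<open>The mean inside \<open>covariance_operator\<close> is existentially quantified;
    testing both mean properties with \<open>h = m\<close> shows that it is
    \<open>0\<close>.\<close>
  have "m \<bullet> m = m \<bullet> 0"
    using m mean unfolding has_mean_def by metis
  then have S: "S h \<bullet> k = (\<integral>x. (h \<bullet> x) * (k \<bullet> x) \<partial>M)" for h k
    using S[of h k] by simp
  have trig: "(\<integral>x. cos (k \<bullet> x) \<partial>M) = exp (- (S k \<bullet> k) / 2)" "(\<integral>x. sin (k \<bullet> x) \<partial>M) = 0" for k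
  proof -
    have meas: "(\<lambda>x. k \<bullet> x) \<in> borel_measurable M"
      by (simp add: measurable_cong_sets[OF sets refl])
    have "bounded_linear (\<lambda>x. k \<bullet> x)" by (rule bounded_linear_inner_right)
    then obtain a s where as: "s \<ge> 0" "distr M borel (\<lambda>x. k \<bullet> x) = gaussian_real a s"
      using assms(1) unfolding gaussian_measure_def by blast
    have "expectation (\<lambda>x. k \<bullet> x) = 0" using mean by (simp add: has_mean_def)
    from gaussian_trig_integrals[OF meas as this]
    show "(\<integral>x. cos (k \<bullet> x) \<partial>M) = exp (- (S k \<bullet> k) / 2)" "(\<integral>x. sin (k \<bullet> x) \<partial>M) = 0"
      by (simp_all add: S power2_eq_square)
  qed
  show ?thesis
  proof (intro centered_gaussian.intro centered_gaussian_axioms.intro prob_space_axioms)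
    show "S h \<bullet> k = h \<bullet> S k" for h k
      using S[of h k] S[of k h] by (simp add: inner_commute mult.commute)
    show "0 \<le> S h \<bullet> h" for h unfolding S by simp
    show "h = 0" if "S h = 0" for h
      using injD[OF \<open>inj S\<close>, of h 0] that linear_0[OF bounded_linear.linear[OF bl]] by simp
  qed (fact sets bl trig)+
qed

theorem corollary2p10:
  fixes \<mu>0 \<mu>y :: "'a::{real_inner, banach, polish_space} measure"
    and \<Sigma> :: "'a \<Rightarrow> 'a"
    and \<Phi> :: "'a \<Rightarrow> real"
    and Z :: real
    and x :: 'a
  assumes "gaussian_measure \<mu>0"
    and "has_mean \<mu>0 0"
    and "covariance_operator \<mu>0 \<Sigma>"
    and "inj \<Sigma>"
    and "borel_prob \<mu>y"
    and "\<Phi> \<in> borel_measurable borel"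
    and "Z > 0"
    and "\<mu>y = density \<mu>0 (\<lambda>u. ennreal (exp (- \<Phi> u) / Z))"
    and "\<forall>r>0. \<exists>L>0. \<forall>x1\<in>ball 0 r. \<forall>x2\<in>ball 0 r. \<bar>\<Phi> x1 - \<Phi> x2\<bar> \<le> L * norm (x1 - x2)"
    and "\<exists>L\<ge>0. \<forall>u. \<Phi> u \<ge> \<Phi> 0 - L * norm u"
  shows "strong_mode \<mu>y x \<longleftrightarrow> weak_mode \<mu>y x"
proof
  have prob: "prob_space \<mu>y" and sets: "sets \<mu>y = sets borel"
    using assms(5) by (auto simp: borel_prob_def)
  show "weak_mode \<mu>y x" if "strong_mode \<mu>y x"
    by (rule strong_mode_imp_weak_mode[OF prob sets that])
  interpret centered_gaussian \<mu>0 \<Sigma>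
    using assms(1-4) by (rule centered_gaussianI)
  obtain K where "K \<ge> 0" "\<And>u. \<Phi> u \<ge> \<Phi> 0 - K * norm u"
    using assms(10) by blast
  then show "strong_mode \<mu>y x" if "weak_mode \<mu>y x"
    using weak_mode_imp_strong_mode[OF assms(6-8) prob assms(9) _ _ that] by blast
qed

end
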